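(* For every dimension $d$, there exists a quantum algorithm that exactly and deterministically implements $U^\dagger$ for an arbitrary $d$-dimensional unitary operator $U$, using at most $d\left\lceil \frac{\pi}{2\Delta_d}\right\rceil - 1$ calls of $U$, where $\Delta_d=\arcsin(1/d)$. That is: for every positive integer $d$ there exist an integer $N\le d\left\lceil \frac{\pi}{2\Delta_d}\right\rceil-1$, a finite-dimensional ancilla space $\mathcal{K}$ with a fixed unit vector $|0\rangle_{\mathrm{anc}}\in\mathcal K$, and fixed unitaries $V_0,\dots,V_N$ on the total space $\mathcal K\otimes\mathbb C^d$ (all independent of $U$) such that for every unitary operator $U$ on $\mathbb{C}^d$ the circuit $$\mathcal C(U)=V_N\,(I_{\mathcal K}\otimes U)\,V_{N-1}\,(I_{\mathcal K}\otimes U)\cdots V_1\,(I_{\mathcal K}\otimes U)\,V_0$$ (containing exactly $N$ occurrences of $U$) satisfies $$\operatorname{Tr}_{\mathcal K}\!\left[\mathcal C(U)\left(|0\rangle\langle 0|_{\mathrm{anc}}\otimes\rho\right)\mathcal C(U)^\dagger\right]=U^\dagger\rho\, U$$ for every density operator $\rho$ on $\mathbb C^d$.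
   Context: A "quantum algorithm using $N$ calls of an unknown unitary $U$" is a quantum circuit with $N$ open slots, each filled by $U$ (acting on one $d$-dimensional system, with the identity on the other systems), interleaved with fixed unitaries independent of $U$, acting on the input system together with ancilla systems initialised in a fixed state. It "implements $U^\dagger$ exactly and deterministically" if, after tracing out the ancillas, the resulting channel on the input system is exactly $\rho\mapsto U^\dagger\rho U$, with no error and no postselection. *)

theory Defs
  imports
    Complex_Main
    "Jordan_Normal_Form.Matrix"
    "Jordan_Normal_Form.Schur_Decomposition"
begin

definition unitary_op :: "nat \<Rightarrow> complex mat \<Rightarrow> bool" where
  "unitary_op n U \<longleftrightarrow> U \<in> carrier_mat n n \<and>
     mat_adjoint U * U = 1\<^sub>m n \<and> U * mat_adjoint U = 1\<^sub>m n"

definition positive_op :: "nat \<Rightarrow> complex mat \<Rightarrow> bool" where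
  "positive_op n A \<longleftrightarrow> A \<in> carrier_mat n n \<and> mat_adjoint A = A \<and>
     (\<forall>v \<in> carrier_vec n. 0 \<le> Re ((A *\<^sub>v v) \<bullet>c v))"

definition density_op :: "nat \<Rightarrow> complex mat \<Rightarrow> bool" where
  "density_op n \<rho> \<longleftrightarrow> positive_op n \<rho> \<and> (\<Sum>i<n. \<rho> $$ (i, i)) = 1"

text \<open>
  The basis vector \<open>e\<^sub>a \<otimes> e\<^sub>i\<close> of \<open>\<complex>\<^sup>k \<otimes> \<complex>\<^sup>d\<close> is the basis vector of \<open>\<complex>\<^sup>k\<^sup>d\<close> with index
  \<open>a * d + i\<close>. Both the tensor product and the partial trace use this identification.
\<close>

definition tensor_op :: "complex mat \<Rightarrow> complex mat \<Rightarrow> complex mat" (infixl "\<otimes>\<^sub>m" 75) where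
  "A \<otimes>\<^sub>m B = mat (dim_row A * dim_row B) (dim_col A * dim_col B)
     (\<lambda>(i, j). A $$ (i div dim_row B, j div dim_col B) * B $$ (i mod dim_row B, j mod dim_col B))"

definition partial_trace_fst :: "nat \<Rightarrow> nat \<Rightarrow> complex mat \<Rightarrow> complex mat" where
  "partial_trace_fst k d M = mat d d (\<lambda>(i, j). \<Sum>a<k. M $$ (a * d + i, a * d + j))"

lemma partial_trace_fst_tensor_op:
  assumes A: "A \<in> carrier_mat k k" and B: "B \<in> carrier_mat d d"
  shows "partial_trace_fst k d (A \<otimes>\<^sub>m B) = (\<Sum>a<k. A $$ (a, a)) \<cdot>\<^sub>m B"
proof (rule eq_matI)
  fix i j assume "i < dim_row ((\<Sum>a<k. A $$ (a, a)) \<cdot>\<^sub>m B)" "j < dim_col ((\<Sum>a<k. A $$ (a, a)) \<cdot>\<^sub>m B)"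
  then have ij: "i < d" "j < d" using B by auto
  have "a * d + l < k * d" if "a < k" "l < d" for a l
  proof -
    have "a * d + l < Suc a * d" using that by simp
    also have "\<dots> \<le> k * d" using that by (intro mult_le_mono1) simp
    finally show ?thesis .
  qed
  then have "(\<Sum>a<k. (A \<otimes>\<^sub>m B) $$ (a * d + i, a * d + j)) = (\<Sum>a<k. A $$ (a, a) * B $$ (i, j))"
    using A B ij by (intro sum.cong) (auto simp: tensor_op_def)
  then show "partial_trace_fst k d (A \<otimes>\<^sub>m B) $$ (i, j) = ((\<Sum>a<k. A $$ (a, a)) \<cdot>\<^sub>m B) $$ (i, j)"
    using B ij by (simp add: partial_trace_fst_def sum_distrib_right)
qed (use B in \<open>auto simp: partial_trace_fst_def\<close>)

definition ket_bra :: "complex vec \<Rightarrow> complex mat" where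
  "ket_bra v = mat (dim_vec v) (dim_vec v) (\<lambda>(i, j). v $ i * cnj (v $ j))"

text \<open>
  \<open>circuit k V U N\<close> is the operator
  \<open>V\<^sub>N (I \<otimes> U) V\<^sub>N\<^sub>-\<^sub>1 (I \<otimes> U) \<cdots> V\<^sub>1 (I \<otimes> U) V\<^sub>0\<close> with \<open>N\<close> calls of \<open>U\<close> and a
  \<open>k\<close>-dimensional ancilla.
\<close>

primrec circuit :: "nat \<Rightarrow> (nat \<Rightarrow> complex mat) \<Rightarrow> complex mat \<Rightarrow> nat \<Rightarrow> complex mat" where
  "circuit k V U 0 = V 0"
| "circuit k V U (Suc n) = V (Suc n) * (1\<^sub>m k \<otimes>\<^sub>m U) * circuit k V U n"

end

theory Submission
  imports Defs
begin

text \<open>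
  A unitary \<open>V\<close> with \<open>V f(x) = g(x)\<close> for all \<open>x\<close> exists as soon as the two families of vectors have the same
  Gram matrix. Hence a circuit need not be written down: it suffices to give, for every call, a
  family of states (indexed by \<open>U\<close> and a basis input \<open>\<psi>\<close>), such that the Gram matrix after each call is the
  one before the next call.

  Write \<open>\<chi> = U\<^sup>\<dagger> \<psi>\<close>, let \<open>\<Phi>\<close> be the maximally entangled state and \<open>sin \<Delta> = 1/d\<close>. Applying the
  conjugate \<open>U\<^sup>*\<close> to \<open>B\<close> in \<open>\<psi>\<^sub>A \<Phi>\<^sub>B\<^sub>C\<close> gives \<open>sin \<Delta> \<Phi>\<^sub>A\<^sub>B \<chi>\<^sub>C + cos \<Delta> b\<close> with a failure state \<open>b\<close> orthogonal to
  \<open>\<Phi>\<^sub>A\<^sub>B\<close>, and \<open>U\<^sup>*\<close> costs \<open>d - 1\<close> calls since \<open>U\<^sup>\<otimes>\<^sup>(\<^sup>d\<^sup>-\<^sup>1\<^sup>)\<close> acts as \<open>det U \<cdot> U\<^sup>*\<close> on antisymmetric states. One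
  more call brings \<open>b\<close> back to \<open>\<psi>\<close>, while a successful \<open>\<chi>\<close> is sent into the part of \<open>U\<^sub>A \<Phi>\<^sub>A\<^sub>B \<chi>\<^sub>C\<close> that is
  orthogonal to \<open>\<psi>\<^sub>A \<Phi>\<^sub>B\<^sub>C\<close>. Under the next \<open>U\<^sup>*\<close> these two interfere, so that each round of \<open>d\<close> calls
  rotates the state by \<open>\<Delta>\<close> towards success; before the last round the amplitude of \<open>\<chi>\<close> is lowered to
  make the final angle exactly \<open>\<pi>/2\<close>. The powers of \<open>det U\<close> are a global phase.
\<close>

subsection \<open>Unitary matrices and Gram matrices\<close>

lemma mat_adjoint_dim [simp]:
  "dim_row (mat_adjoint A) = dim_col A" "dim_col (mat_adjoint A) = dim_row A"
  by (auto simp: mat_adjoint_def)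

lemma mat_adjoint_index [simp]:
  fixes A :: "complex mat"
  assumes "i < dim_col A" "j < dim_row A"
  shows "mat_adjoint A $$ (i, j) = cnj (A $$ (j, i))"
  using assms by (simp add: mat_adjoint_def mat_of_rows_index)

lemma mat_adjoint_carrier [simp]:
  "A \<in> carrier_mat m n \<Longrightarrow> mat_adjoint A \<in> carrier_mat n m"
  by (auto intro: carrier_matI)

lemma mat_adjoint_adjoint [simp]: "mat_adjoint (mat_adjoint A) = (A :: complex mat)"
  by (rule eq_matI) auto

lemma mat_adjoint_mult:
  fixes A B :: "complex mat"
  assumes "A \<in> carrier_mat m n" "B \<in> carrier_mat n p"
  shows "mat_adjoint (A * B) = mat_adjoint B * mat_adjoint A"
  using assms by (intro eq_matI) (auto simp: scalar_prod_def mult.commute)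

lemma mat_adjoint_one [simp]: "mat_adjoint (1\<^sub>m n :: complex mat) = 1\<^sub>m n"
  by (rule eq_matI) auto

lemma cscalar_prod_sum:
  fixes v w :: "complex vec"
  assumes "w \<in> carrier_vec n"
  shows "v \<bullet>c w = (\<Sum>i<n. v $ i * cnj (w $ i))"
  using assms by (auto simp: scalar_prod_def atLeast0LessThan)

lemma mult_mat_vec_sum:
  assumes "A \<in> carrier_mat m n" "v \<in> carrier_vec n" "i < m"
  shows "(A *\<^sub>v v) $ i = (\<Sum>j<n. A $$ (i, j) * v $ j)"
  using assms by (auto simp: scalar_prod_def atLeast0LessThan)

lemma cscalar_prod_adjoint:
  fixes A :: "complex mat"
  assumes "A \<in> carrier_mat m n" "v \<in> carrier_vec n" "w \<in> carrier_vec m"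
  shows "(A *\<^sub>v v) \<bullet>c w = v \<bullet>c (mat_adjoint A *\<^sub>v w)"
proof -
  have "(A *\<^sub>v v) \<bullet>c w = (\<Sum>i<m. \<Sum>j<n. A $$ (i, j) * v $ j * cnj (w $ i))"
    using assms by (simp add: cscalar_prod_sum[of _ m] mult_mat_vec_sum[of A m n] sum_distrib_right
        del: index_mult_mat_vec)
  also have "\<dots> = (\<Sum>j<n. \<Sum>i<m. A $$ (i, j) * v $ j * cnj (w $ i))"
    by (rule sum.swap)
  also have "\<dots> = v \<bullet>c (mat_adjoint A *\<^sub>v w)"
    using assms
    by (subst cscalar_prod_sum[of _ n])
      (auto intro: mult_mat_vec_carrier[of _ n m] simp: mult_mat_vec_sum[of "mat_adjoint A" n m] sum_distrib_left ac_simps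
        simp del: index_mult_mat_vec intro!: sum.cong)
  finally show ?thesis .
qed

lemma unitary_opD:
  assumes "unitary_op n U"
  shows "U \<in> carrier_mat n n" "mat_adjoint U * U = 1\<^sub>m n" "U * mat_adjoint U = 1\<^sub>m n"
  using assms by (auto simp: unitary_op_def)

lemma unitary_op_one: "unitary_op n (1\<^sub>m n)"
  by (simp add: unitary_op_def)

lemma unitary_op_adjoint: "unitary_op n U \<Longrightarrow> unitary_op n (mat_adjoint U)"
  by (auto simp: unitary_op_def)

lemma unitary_op_mult:
  assumes "unitary_op n A" "unitary_op n B"
  shows "unitary_op n (A * B)"
proof -
  note A = unitary_opD[OF assms(1)] and B = unitary_opD[OF assms(2)]
  have "mat_adjoint (A * B) * (A * B) = mat_adjoint B * ((mat_adjoint A * A) * B)"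
    using A(1) B(1)
    by (simp add: mat_adjoint_mult[of _ n n _ n] assoc_mult_mat[of _ n n _ n _ n] mult_carrier_mat[of _ n n _ n])
  moreover have "(A * B) * mat_adjoint (A * B) = A * ((B * mat_adjoint B) * mat_adjoint A)"
    using A(1) B(1)
    by (simp add: mat_adjoint_mult[of _ n n _ n] assoc_mult_mat[of _ n n _ n _ n] mult_carrier_mat[of _ n n _ n])
  ultimately show ?thesis
    using A B by (simp add: unitary_op_def)
qed

lemma unitary_op_cscalar_prod:
  assumes "unitary_op n A" "v \<in> carrier_vec n" "w \<in> carrier_vec n"
  shows "(A *\<^sub>v v) \<bullet>c (A *\<^sub>v w) = v \<bullet>c w"
proof -
  note A = unitary_opD[OF assms(1)]
  have "mat_adjoint A *\<^sub>v (A *\<^sub>v w) = w"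
    using A assms by (simp flip: assoc_mult_mat_vec[of _ n n _ n])
  then show ?thesis
    using A assms by (simp add: cscalar_prod_adjoint[of A n n])
qed

lemma unitary_op_row_sum:
  assumes "unitary_op n U" "i < n" "j < n"
  shows "(\<Sum>k<n. U $$ (i, k) * cnj (U $$ (j, k))) = (if i = j then 1 else 0)"
proof -
  note U = unitary_opD[OF assms(1)]
  have "(U * mat_adjoint U) $$ (i, j) = (\<Sum>k<n. U $$ (i, k) * cnj (U $$ (j, k)))"
    using U(1) assms by (auto simp: scalar_prod_def atLeast0LessThan)
  then show ?thesis using U assms by simp
qed

lemma unitary_op_col_sum:
  assumes "unitary_op n U" "i < n" "j < n"
  shows "(\<Sum>k<n. U $$ (k, i) * cnj (U $$ (k, j))) = (if i = j then 1 else 0)"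
proof -
  note U = unitary_opD[OF assms(1)]
  have "(mat_adjoint U * U) $$ (j, i) = (\<Sum>k<n. U $$ (k, i) * cnj (U $$ (k, j)))"
    using U(1) assms by (auto simp: scalar_prod_def atLeast0LessThan mult.commute)
  then show ?thesis using U assms by auto
qed

text \<open>With \<open>z = u - w\<close> the condition \<open>2 Re \<langle>u, z\<rangle> = \<langle>z, z\<rangle>\<close> expresses \<open>\<bar>u\<bar> = \<bar>w\<bar>\<close>, and it is exactly what
  makes the complex reflection \<open>1 - z z\<^sup>\<dagger> / \<langle>u, z\<rangle>\<close> unitary, whatever the phase of \<open>\<langle>u, w\<rangle>\<close>.\<close>

lemma unitary_op_reflection:
  assumes u: "u \<in> carrier_vec n" and w: "w \<in> carrier_vec n" and uw: "u \<bullet>c u = w \<bullet>c w"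
  obtains A where "unitary_op n A" "A *\<^sub>v u = w"
    "\<And>v. v \<in> carrier_vec n \<Longrightarrow> \<exists>c. A *\<^sub>v v = v - c \<cdot>\<^sub>v (u - w)"
proof (cases "u = w")
  case True
  have "\<exists>c. 1\<^sub>m n *\<^sub>v v = v - c \<cdot>\<^sub>v (u - w)" if "v \<in> carrier_vec n" for v
    using that u w by (intro exI[of _ 0] eq_vecI) auto
  with True u show ?thesis by (intro that[of "1\<^sub>m n"]) (auto simp: unitary_op_one)
next
  case False
  define z where "z = u - w"
  define q where "q = u \<bullet>c z"
  have z: "z \<in> carrier_vec n" using u w by (simp add: z_def)
  have zi: "z $ i = u $ i - w $ i" if "i < n" for i using that u w by (simp add: z_def)
  have zz: "z \<bullet>c z = q + cnj q"
  proof -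
    have "z \<bullet>c z = (\<Sum>i<n. u $ i * cnj (z $ i) + cnj (u $ i) * z $ i + (w $ i * cnj (w $ i) - u $ i * cnj (u $ i)))"
      using z by (subst cscalar_prod_sum[OF z], intro sum.cong) (auto simp: zi algebra_simps)
    also have "\<dots> = q + cnj q + (w \<bullet>c w - u \<bullet>c u)"
      by (simp add: sum.distrib sum_subtractf q_def cscalar_prod_sum[OF z] cscalar_prod_sum[OF u]
          cscalar_prod_sum[OF w])
    finally show ?thesis using uw by simp
  qed
  have "z \<noteq> 0\<^sub>v n"
  proof
    assume "z = 0\<^sub>v n"
    then have "z $ i = 0" if "i < n" for i using that by simp
    with zi have "u = w" using u w by (intro eq_vecI) auto
    with False show False ..
  qed
  then have "z \<bullet>c z \<noteq> 0" using conjugate_square_eq_0_vec[OF z] by simp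
  with zz have q: "q \<noteq> 0" by auto
  define s where "s = 1 / q"
  \<comment> \<open>This is the unitarity condition for \<open>1 - s z z^dagger\<close>. It is
    symmetric in \<open>s\<close> and \<open>cnj s\<close>, so the single product computed below
    settles both orders.\<close>
  have s: "s + cnj s = s * cnj s * (z \<bullet>c z)"
    using q by (simp add: s_def zz field_simps)
  define A where "A = mat n n (\<lambda>(i, j). (if i = j then 1 else 0) - s * z $ i * cnj (z $ j))"
  have A: "A \<in> carrier_mat n n" by (simp add: A_def)
  have Av: "A *\<^sub>v v = v - (s * (v \<bullet>c z)) \<cdot>\<^sub>v z" if v: "v \<in> carrier_vec n" for v
  proof (rule eq_vecI)
    fix i assume "i < dim_vec (v - (s * (v \<bullet>c z)) \<cdot>\<^sub>v z)"
    then have i: "i < n" using z by simp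
    have "(A *\<^sub>v v) $ i = (\<Sum>j<n. (if i = j then v $ j else 0) - s * z $ i * (v $ j * cnj (z $ j)))"
      unfolding mult_mat_vec_sum[OF A v i] using i by (intro sum.cong) (auto simp: A_def algebra_simps)
    also have "\<dots> = v $ i - s * z $ i * (v \<bullet>c z)"
      using i by (simp add: sum_subtractf cscalar_prod_sum[OF z] sum_distrib_left)
    finally show "(A *\<^sub>v v) $ i = (v - (s * (v \<bullet>c z)) \<cdot>\<^sub>v z) $ i"
      using i v z by (simp add: ac_simps)
  qed (use A z in auto)
  have *: "(\<Sum>k<n. ((if i = k then 1 else 0) - a * z $ i * cnj (z $ k))
        * ((if k = j then 1 else 0) - b * z $ k * cnj (z $ j))) = (if i = j then 1 else 0)"
    if "i < n" "j < n" "a + b = a * b * (z \<bullet>c z)" for i j a b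
  proof -
    have "(\<Sum>k<n. ((if i = k then 1 else 0) - a * z $ i * cnj (z $ k))
        * ((if k = j then 1 else 0) - b * z $ k * cnj (z $ j)))
      = (\<Sum>k<n. (if i = k then (if k = j then 1 else 0) - b * z $ k * cnj (z $ j) else 0)
          - (if k = j then a * z $ i * cnj (z $ k) else 0)
          + a * b * z $ i * cnj (z $ j) * (z $ k * cnj (z $ k)))"
      by (intro sum.cong) (auto simp: algebra_simps)
    also have "\<dots> = (if i = j then 1 else 0) - (a + b - a * b * (z \<bullet>c z)) * z $ i * cnj (z $ j)"
      using that(1,2) by (simp add: sum.distrib sum_subtractf cscalar_prod_sum[OF z] sum_distrib_left algebra_simps)
    finally show ?thesis using that(3) by simp
  qed
  have "unitary_op n A"
    unfolding unitary_op_def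
  proof (intro conjI A eq_matI)
    fix i j assume "i < dim_row (1\<^sub>m n :: complex mat)" "j < dim_col (1\<^sub>m n :: complex mat)"
    then have ij: "i < n" "j < n" by auto
    have "(mat_adjoint A * A) $$ (i, j) = (\<Sum>k<n. ((if i = k then 1 else 0) - cnj s * z $ i * cnj (z $ k))
        * ((if k = j then 1 else 0) - s * z $ k * cnj (z $ j)))"
      using ij A by (auto simp: scalar_prod_def atLeast0LessThan A_def intro!: sum.cong)
    then show "(mat_adjoint A * A) $$ (i, j) = 1\<^sub>m n $$ (i, j)"
      using *[of i j "cnj s" s] s ij by (simp add: ac_simps)
    have "(A * mat_adjoint A) $$ (i, j) = (\<Sum>k<n. ((if i = k then 1 else 0) - s * z $ i * cnj (z $ k))
        * ((if k = j then 1 else 0) - cnj s * z $ k * cnj (z $ j)))"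
      using ij A by (auto simp: scalar_prod_def atLeast0LessThan A_def intro!: sum.cong)
    then show "(A * mat_adjoint A) $$ (i, j) = 1\<^sub>m n $$ (i, j)"
      using *[of i j s "cnj s"] s ij by (simp add: ac_simps)
  qed (use A in auto)
  moreover have "A *\<^sub>v u = w"
  proof (rule eq_vecI)
    fix i assume "i < dim_vec w"
    then show "(A *\<^sub>v u) $ i = w $ i"
      using Av[OF u] q u w z by (simp add: zi s_def flip: q_def)
  qed (use A w in auto)
  ultimately show ?thesis using Av that by (metis z_def)
qed

text \<open>The index set may be infinite, so the vectors are not handled one at a time. The
  induction runs over coordinates instead: two reflections, one for each family, make one more
  coordinate of \<open>f\<close> and \<open>g\<close> agree.\<close>

lemma unitary_op_of_gram:
  assumes "\<And>x. x \<in> X \<Longrightarrow> f x \<in> carrier_vec n" "\<And>x. x \<in> X \<Longrightarrow> g x \<in> carrier_vec n"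
    and "\<And>x y. x \<in> X \<Longrightarrow> y \<in> X \<Longrightarrow> f x \<bullet>c f y = g x \<bullet>c g y"
  shows "\<exists>V. unitary_op n V \<and> (\<forall>x\<in>X. V *\<^sub>v f x = g x)"
proof -
  \<comment> \<open>Only the first \<open>m\<close> coordinates of the two families may differ:
    \<open>m = n\<close> is the lemma itself, and at \<open>m = 0\<close> the families are
    equal.\<close>
  have "\<exists>V. unitary_op n V \<and> (\<forall>x\<in>X. V *\<^sub>v f x = g x)"
    if "m \<le> n" "\<And>x i. x \<in> X \<Longrightarrow> m \<le> i \<Longrightarrow> i < n \<Longrightarrow> f x $ i = g x $ i"
      "\<And>x. x \<in> X \<Longrightarrow> f x \<in> carrier_vec n" "\<And>x. x \<in> X \<Longrightarrow> g x \<in> carrier_vec n"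
      "\<And>x y. x \<in> X \<Longrightarrow> y \<in> X \<Longrightarrow> f x \<bullet>c f y = g x \<bullet>c g y" for m f g
    using that
  proof (induction m arbitrary: f g)
    case 0
    then have "f x = g x" if "x \<in> X" for x
      using 0(2)[OF that] 0(3)[OF that] 0(4)[OF that] by (intro eq_vecI) auto
    with 0 show ?case by (intro exI[of _ "1\<^sub>m n"]) (auto simp: unitary_op_one)
  next
    case (Suc m)
    note fc = Suc.prems(3) and gc = Suc.prems(4)
    have m: "m < n" using Suc.prems by simp
    define tr where "tr v = vec n (\<lambda>i. if i \<le> m then v $ i else 0)" for v :: "complex vec"
    have tr: "tr v \<in> carrier_vec n" for v by (simp add: tr_def)
    have split: "v \<bullet>c w = v \<bullet>c tr w + (\<Sum>i\<in>{m<..<n}. v $ i * cnj (w $ i))"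
      if "w \<in> carrier_vec n" for v w
    proof -
      have "v \<bullet>c w = (\<Sum>i\<in>{..<n}. (if i \<le> m then v $ i * cnj (w $ i) else 0)
          + (if i \<in> {m<..<n} then v $ i * cnj (w $ i) else 0))"
        unfolding cscalar_prod_sum[OF that] by (intro sum.cong) auto
      also have "\<dots> = v \<bullet>c tr w + (\<Sum>i\<in>{..<n}. if i \<in> {m<..<n} then v $ i * cnj (w $ i) else 0)"
        unfolding sum.distrib cscalar_prod_sum[OF tr]
        by (intro arg_cong2[where f = "(+)"] sum.cong) (auto simp: tr_def)
      also have "(\<Sum>i\<in>{..<n}. if i \<in> {m<..<n} then v $ i * cnj (w $ i) else 0)
          = (\<Sum>i\<in>{m<..<n}. v $ i * cnj (w $ i))"
        by (subst sum.inter_restrict[symmetric]) (auto intro: sum.cong)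
      finally show ?thesis .
    qed
    \<comment> \<open>Coordinates beyond \<open>m\<close> agree, hence contribute equally to both
      Gram matrices and can be subtracted.\<close>
    have trg: "f x \<bullet>c tr (f y) = g x \<bullet>c tr (g y)" if "x \<in> X" "y \<in> X" for x y
    proof -
      have "(\<Sum>i\<in>{m<..<n}. f x $ i * cnj (f y $ i)) = (\<Sum>i\<in>{m<..<n}. g x $ i * cnj (g y $ i))"
        using Suc.prems(2) that by (intro sum.cong) auto
      then show ?thesis
        using split[OF fc, of y "f x"] split[OF gc, of y "g x"] Suc.prems(5)[of x y] that by simp
    qed
    have trtr: "v \<bullet>c tr w = tr v \<bullet>c tr w" if "v \<in> carrier_vec n" for v w
      unfolding cscalar_prod_sum[OF tr] by (intro sum.cong) (auto simp: tr_def)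
    show ?case
    proof (cases "\<forall>x\<in>X. tr (f x) = 0\<^sub>v n")
      case True
      \<comment> \<open>A vanishing truncation of \<open>f x\<close> forces that of
        \<open>g x\<close> to vanish, since the two have equal norms.\<close>
      have "f x $ m = g x $ m" if x: "x \<in> X" for x
      proof -
        have "tr (g x) \<bullet>c tr (g x) = tr (f x) \<bullet>c tr (f x)"
          using trg[OF x x] trtr[OF fc[OF x]] trtr[OF gc[OF x]] by simp
        also have "\<dots> = 0" using True x by simp
        finally have "tr (g x) = 0\<^sub>v n" using conjugate_square_eq_0_vec[OF tr] by blast
        then have "tr (g x) $ m = tr (f x) $ m" using True x by simp
        with m show ?thesis by (simp add: tr_def)
      qed
      then have "f x $ i = g x $ i" if "x \<in> X" "m \<le> i" "i < n" for x i
        using that Suc.prems(2) by (cases "i = m") auto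
      then show ?thesis using Suc.IH[of f g] Suc.prems by auto
    next
      case False
      then obtain x0 where x0: "x0 \<in> X" "tr (f x0) \<noteq> 0\<^sub>v n" by auto
      \<comment> \<open>Both reflections aim at this same \<open>e\<close>, a positive multiple of
        the unit vector of coordinate \<open>m\<close>, so that coordinate can be read off from the
        inner product with \<open>e\<close>.\<close>
      define e where "e = (complex_of_real (sqrt (Re (tr (f x0) \<bullet>c tr (f x0))))) \<cdot>\<^sub>v unit_vec n m"
      have e: "e \<in> carrier_vec n" by (simp add: e_def)
      have pos: "tr (f x0) \<bullet>c tr (f x0) > 0"
        using conjugate_square_greater_0_vec[OF tr] x0 by blast
      then have re: "Re (tr (f x0) \<bullet>c tr (f x0)) > 0" "Im (tr (f x0) \<bullet>c tr (f x0)) = 0"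
        by (auto simp: less_complex_def)
      have cee: "v \<bullet>c e = v $ m * complex_of_real (sqrt (Re (tr (f x0) \<bullet>c tr (f x0))))" for v
      proof -
        have "v \<bullet>c e = (\<Sum>i<n. if i = m then v $ i * complex_of_real (sqrt (Re (tr (f x0) \<bullet>c tr (f x0)))) else 0)"
          unfolding cscalar_prod_sum[OF e] using m by (intro sum.cong) (auto simp: e_def)
        then show ?thesis using m by simp
      qed
      have "e \<bullet>c e = complex_of_real (Re (tr (f x0) \<bullet>c tr (f x0)))"
        using re m unfolding cee by (simp add: e_def flip: of_real_mult)
      then have ee: "tr (f x0) \<bullet>c tr (f x0) = e \<bullet>c e"
        using re by (simp add: complex_eq_iff)
      have ge: "tr (g x0) \<bullet>c tr (g x0) = e \<bullet>c e"
        using ee trg[OF x0(1) x0(1)] trtr[OF fc[OF x0(1)]] trtr[OF gc[OF x0(1)]] by simp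
      obtain A where A: "unitary_op n A" "A *\<^sub>v tr (f x0) = e"
        "\<And>v. v \<in> carrier_vec n \<Longrightarrow> \<exists>c. A *\<^sub>v v = v - c \<cdot>\<^sub>v (tr (f x0) - e)"
        using unitary_op_reflection[OF tr e ee] by metis
      obtain B where B: "unitary_op n B" "B *\<^sub>v tr (g x0) = e"
        "\<And>v. v \<in> carrier_vec n \<Longrightarrow> \<exists>c. B *\<^sub>v v = v - c \<cdot>\<^sub>v (tr (g x0) - e)"
        using unitary_op_reflection[OF tr e ge] by metis
      note Ac = unitary_opD(1)[OF A(1)] and Bc = unitary_opD(1)[OF B(1)]
      \<comment> \<open>Coordinate \<open>m\<close> is compared through the inner product with
        \<open>e\<close>. Later coordinates are left alone, because the reflection directions are
        supported on coordinates up to \<open>m\<close>.\<close>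
      have "(A *\<^sub>v f x) $ i = (B *\<^sub>v g x) $ i" if x: "x \<in> X" and i: "m \<le> i" "i < n" for x i
      proof (cases "i = m")
        case True
        have "(A *\<^sub>v f x) \<bullet>c e = (B *\<^sub>v g x) \<bullet>c e"
          using unitary_op_cscalar_prod[OF A(1) fc[OF x] tr] unitary_op_cscalar_prod[OF B(1) gc[OF x] tr]
            trg[OF x x0(1)] A(2) B(2) by metis
        then show ?thesis using re True unfolding cee by simp
      next
        case False
        obtain a b where a: "A *\<^sub>v f x = f x - a \<cdot>\<^sub>v (tr (f x0) - e)"
          and b: "B *\<^sub>v g x = g x - b \<cdot>\<^sub>v (tr (g x0) - e)"
          using A(3)[OF fc[OF x]] B(3)[OF gc[OF x]] by blast
        show ?thesis
          unfolding a b using False i m Suc.prems(2)[OF x, of i] fc[OF x] gc[OF x]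
          by (simp add: tr_def e_def)
      qed
      then obtain V where V: "unitary_op n V" "\<And>x. x \<in> X \<Longrightarrow> V *\<^sub>v (A *\<^sub>v f x) = B *\<^sub>v g x"
        using Suc.IH[of "\<lambda>x. A *\<^sub>v f x" "\<lambda>x. B *\<^sub>v g x"] m Ac Bc fc gc Suc.prems(5)
        by (auto simp: unitary_op_cscalar_prod[OF A(1)] unitary_op_cscalar_prod[OF B(1)])
      note Vc = unitary_opD(1)[OF V(1)]
      have "(mat_adjoint B * (V * A)) *\<^sub>v f x = g x" if x: "x \<in> X" for x
      proof -
        have "(mat_adjoint B * (V * A)) *\<^sub>v f x = mat_adjoint B *\<^sub>v (V *\<^sub>v (A *\<^sub>v f x))"
          using Ac Bc Vc fc[OF x] by (simp add: assoc_mult_mat_vec[of _ n n _ n])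
        also have "\<dots> = (mat_adjoint B * B) *\<^sub>v g x"
          using V(2)[OF x] Bc gc[OF x] by (simp add: assoc_mult_mat_vec[of _ n n _ n])
        finally show ?thesis using unitary_opD(2)[OF B(1)] gc[OF x] by simp
      qed
      moreover have "unitary_op n (mat_adjoint B * (V * A))"
        by (intro unitary_op_mult unitary_op_adjoint A B V)
      ultimately show ?thesis by blast
    qed
  qed
  from this[of n f g] show ?thesis using assms by auto
qed

subsection \<open>Gram kernels and calls\<close>

text \<open>The pair \<open>(U, i)\<close> stands for the run of a circuit with oracle \<open>U\<close> on the basis vector \<open>e\<^sub>i\<close>.\<close>

definition inputs :: "nat \<Rightarrow> (complex mat \<times> nat) set" where
  "inputs d = {(U, i). unitary_op d U \<and> i < d}"

definition gram :: "'a set \<Rightarrow> ('x \<Rightarrow> 'a \<Rightarrow> complex) \<Rightarrow> ('x \<Rightarrow> 'a \<Rightarrow> complex) \<Rightarrow> 'x \<Rightarrow> 'x \<Rightarrow> complex" where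
  "gram I f g x y = (\<Sum>a\<in>I. f x a * cnj (g y a))"

definition apply_call :: "nat \<Rightarrow> (complex mat \<times> nat \<Rightarrow> 'a \<times> nat \<Rightarrow> complex) \<Rightarrow>
    complex mat \<times> nat \<Rightarrow> 'a \<times> nat \<Rightarrow> complex" where
  "apply_call d f x = (\<lambda>(a, i). \<Sum>j<d. fst x $$ (i, j) * f x (a, j))"

text \<open>States and ancilla size are hidden under the quantifier: any states with the same kernel
  are related by a unitary independent of the oracle, so only the kernels matter for
  composition.\<close>

definition call_step :: "nat \<Rightarrow> (complex mat \<times> nat \<Rightarrow> complex mat \<times> nat \<Rightarrow> complex) \<Rightarrow>
    (complex mat \<times> nat \<Rightarrow> complex mat \<times> nat \<Rightarrow> complex) \<Rightarrow> bool" where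
  "call_step d G H \<longleftrightarrow> (\<exists>k f. \<forall>x\<in>inputs d. \<forall>y\<in>inputs d.
     gram ({..<k::nat} \<times> {..<d}) f f x y = G x y \<and>
     gram ({..<k} \<times> {..<d}) (apply_call d f) (apply_call d f) x y = H x y)"

text \<open>Lets ancilla labels be tuples, functions or elements of a disjoint sum instead of
  numbers.\<close>

lemma call_stepI:
  fixes A :: "'a set"
  assumes A: "finite A"
    and "\<And>x y. x \<in> inputs d \<Longrightarrow> y \<in> inputs d \<Longrightarrow> gram (A \<times> {..<d}) f f x y = G x y"
    and "\<And>x y. x \<in> inputs d \<Longrightarrow> y \<in> inputs d \<Longrightarrow>
      gram (A \<times> {..<d}) (apply_call d f) (apply_call d f) x y = H x y"
  shows "call_step d G H"
proof -
  obtain h where h: "bij_betw h {..<card A} A"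
    using ex_bij_betw_nat_finite[OF A] atLeast0LessThan by metis
  define f' where "f' x = (\<lambda>(n, i). f x (h n, i))" for x
  have bij: "bij_betw (\<lambda>(n, i). (h n, i)) ({..<card A} \<times> {..<d}) (A \<times> {..<d})"
    using bij_betw_map_prod[OF h bij_betw_id[of "{..<d}"]] by (simp add: map_prod_def)
  have "gram ({..<card A} \<times> {..<d}) f' f' x y = gram (A \<times> {..<d}) f f x y" for x y
    unfolding gram_def sum.reindex_bij_betw[OF bij, symmetric]
    by (intro sum.cong) (auto simp: f'_def)
  moreover have "gram ({..<card A} \<times> {..<d}) (apply_call d f') (apply_call d f') x y
      = gram (A \<times> {..<d}) (apply_call d f) (apply_call d f) x y" for x y
    unfolding gram_def sum.reindex_bij_betw[OF bij, symmetric]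
    by (intro sum.cong) (auto simp: f'_def apply_call_def)
  ultimately show ?thesis
    unfolding call_step_def using assms(2,3) by metis
qed

lemma call_step_cong:
  assumes "call_step d G H"
    and "\<And>x y. x \<in> inputs d \<Longrightarrow> y \<in> inputs d \<Longrightarrow> G x y = G' x y"
    and "\<And>x y. x \<in> inputs d \<Longrightarrow> y \<in> inputs d \<Longrightarrow> H x y = H' x y"
  shows "call_step d G' H'"
  using assms unfolding call_step_def by metis

section \<open>Scaling, superposing and composing calls\<close>

lemma gram_scale:
  "gram I (\<lambda>x a. p x * f x a) (\<lambda>x a. q x * g x a) x y = p x * cnj (q y) * gram I f g x y"
  by (simp add: gram_def sum_distrib_left ac_simps)

lemma gram_add_left: "gram I (\<lambda>x a. f x a + f' x a) g x y = gram I f g x y + gram I f' g x y"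
  by (simp add: gram_def sum.distrib algebra_simps)

lemma gram_add_right: "gram I f (\<lambda>x a. g x a + g' x a) x y = gram I f g x y + gram I f g' x y"
  by (simp add: gram_def sum.distrib algebra_simps)

lemma apply_call_scale:
  "apply_call d (\<lambda>x a. p x * f x a) = (\<lambda>x a. p x * apply_call d f x a)"
  by (auto simp: apply_call_def fun_eq_iff sum_distrib_left ac_simps)

text \<open>A call is linear on each run separately, so every run may carry its own scalar. The
  modulus of \<open>p x\<close> is arbitrary; a constant square root gives scaling by a nonnegative
  number.\<close>

lemma call_step_phase:
  assumes "call_step d G H"
  shows "call_step d (\<lambda>x y. p x * cnj (p y) * G x y) (\<lambda>x y. p x * cnj (p y) * H x y)"
proof -
  obtain k f where f: "\<forall>x\<in>inputs d. \<forall>y\<in>inputs d. gram ({..<k::nat} \<times> {..<d}) f f x y = G x y \<and>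
      gram ({..<k} \<times> {..<d}) (apply_call d f) (apply_call d f) x y = H x y"
    using assms unfolding call_step_def by blast
  show ?thesis
    by (rule call_stepI[of "{..<k}" _ "\<lambda>x a. p x * f x a"])
      (simp_all add: gram_scale apply_call_scale f)
qed

lemma call_step_scale:
  assumes "call_step d G H" "r \<ge> 0"
  shows "call_step d (\<lambda>x y. complex_of_real r * G x y) (\<lambda>x y. complex_of_real r * H x y)"
  using call_step_phase[OF assms(1), of "\<lambda>_. complex_of_real (sqrt r)"] assms(2)
  by (simp flip: of_real_mult)

text \<open>The two families are placed in orthogonal blocks of a larger ancilla. One call acts on
  both blocks at once, so branches are added without further calls.\<close>

lemma call_step_add:
  assumes "call_step d G H" "call_step d G' H'"
  shows "call_step d (\<lambda>x y. G x y + G' x y) (\<lambda>x y. H x y + H' x y)"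
proof -
  obtain k f where f: "\<forall>x\<in>inputs d. \<forall>y\<in>inputs d. gram ({..<k::nat} \<times> {..<d}) f f x y = G x y \<and>
      gram ({..<k} \<times> {..<d}) (apply_call d f) (apply_call d f) x y = H x y"
    using assms(1) unfolding call_step_def by blast
  obtain k' f' where f': "\<forall>x\<in>inputs d. \<forall>y\<in>inputs d. gram ({..<k'::nat} \<times> {..<d}) f' f' x y = G' x y \<and>
      gram ({..<k'} \<times> {..<d}) (apply_call d f') (apply_call d f') x y = H' x y"
    using assms(2) unfolding call_step_def by blast
  define h where "h x = (\<lambda>(a, i). case a of Inl b \<Rightarrow> f x (b, i) | Inr b \<Rightarrow> f' x (b, i))" for x
  have sum: "(\<Sum>a\<in>({..<k} <+> {..<k'}) \<times> {..<d}. F a)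
      = (\<Sum>a\<in>{..<k} \<times> {..<d}. F (Inl (fst a), snd a)) + (\<Sum>a\<in>{..<k'} \<times> {..<d}. F (Inr (fst a), snd a))"
    for F :: "(nat + nat) \<times> nat \<Rightarrow> complex"
    unfolding sum.cartesian_product' by (simp add: sum.Plus)
  show ?thesis
  proof (rule call_stepI[of "{..<k} <+> {..<k'}" _ h])
    fix x y assume xy: "x \<in> inputs d" "y \<in> inputs d"
    have "gram (({..<k} <+> {..<k'}) \<times> {..<d}) h h x y
        = gram ({..<k} \<times> {..<d}) f f x y + gram ({..<k'} \<times> {..<d}) f' f' x y"
      unfolding gram_def sum by (simp add: h_def)
    with f f' xy show "gram (({..<k} <+> {..<k'}) \<times> {..<d}) h h x y = G x y + G' x y" by simp
    have "gram (({..<k} <+> {..<k'}) \<times> {..<d}) (apply_call d h) (apply_call d h) x y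
        = gram ({..<k} \<times> {..<d}) (apply_call d f) (apply_call d f) x y
          + gram ({..<k'} \<times> {..<d}) (apply_call d f') (apply_call d f') x y"
      unfolding gram_def sum by (simp add: h_def apply_call_def case_prod_unfold)
    with f f' xy show "gram (({..<k} <+> {..<k'}) \<times> {..<d}) (apply_call d h) (apply_call d h) x y
        = H x y + H' x y" by simp
  qed auto
qed

text \<open>The unitaries between calls preserve Gram kernels, so a protocol is merely a chain of
  kernels.\<close>

definition calls :: "nat \<Rightarrow> nat \<Rightarrow> (complex mat \<times> nat \<Rightarrow> complex mat \<times> nat \<Rightarrow> complex) \<Rightarrow>
    (complex mat \<times> nat \<Rightarrow> complex mat \<times> nat \<Rightarrow> complex) \<Rightarrow> bool" where
  "calls d n G H \<longleftrightarrow> (\<exists>K. (\<forall>j<n. call_step d (K j) (K (Suc j))) \<and>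
     (\<forall>x\<in>inputs d. \<forall>y\<in>inputs d. K 0 x y = G x y \<and> K n x y = H x y))"

lemma callsE:
  assumes "calls d n G H"
  obtains K where "\<And>j. j < n \<Longrightarrow> call_step d (K j) (K (Suc j))"
    "\<And>x y. x \<in> inputs d \<Longrightarrow> y \<in> inputs d \<Longrightarrow> K 0 x y = G x y"
    "\<And>x y. x \<in> inputs d \<Longrightarrow> y \<in> inputs d \<Longrightarrow> K n x y = H x y"
  using assms unfolding calls_def by blast

lemma callsI:
  assumes "\<And>j. j < n \<Longrightarrow> call_step d (K j) (K (Suc j))"
    "\<And>x y. x \<in> inputs d \<Longrightarrow> y \<in> inputs d \<Longrightarrow> K 0 x y = G x y"
    "\<And>x y. x \<in> inputs d \<Longrightarrow> y \<in> inputs d \<Longrightarrow> K n x y = H x y"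
  shows "calls d n G H"
  using assms unfolding calls_def by blast

lemma calls_cong:
  assumes "calls d n G H"
    and "\<And>x y. x \<in> inputs d \<Longrightarrow> y \<in> inputs d \<Longrightarrow> G x y = G' x y"
    and "\<And>x y. x \<in> inputs d \<Longrightarrow> y \<in> inputs d \<Longrightarrow> H x y = H' x y"
  shows "calls d n G' H'"
  using assms unfolding calls_def by metis

lemma calls_single: "call_step d G H \<Longrightarrow> calls d 1 G H"
  by (rule callsI[of 1 d "\<lambda>j. if j = 0 then G else H"]) auto

lemma calls_trans:
  assumes "calls d m F G" "calls d n G H"
  shows "calls d (m + n) F H"
proof -
  obtain K where K: "\<And>j. j < m \<Longrightarrow> call_step d (K j) (K (Suc j))"
    "\<And>x y. x \<in> inputs d \<Longrightarrow> y \<in> inputs d \<Longrightarrow> K 0 x y = F x y"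
    "\<And>x y. x \<in> inputs d \<Longrightarrow> y \<in> inputs d \<Longrightarrow> K m x y = G x y"
    using callsE[OF assms(1)] by metis
  obtain L where L: "\<And>j. j < n \<Longrightarrow> call_step d (L j) (L (Suc j))"
    "\<And>x y. x \<in> inputs d \<Longrightarrow> y \<in> inputs d \<Longrightarrow> L 0 x y = G x y"
    "\<And>x y. x \<in> inputs d \<Longrightarrow> y \<in> inputs d \<Longrightarrow> L n x y = H x y"
    using callsE[OF assms(2)] by metis
  \<comment> \<open>\<open>K m\<close> and \<open>L 0\<close> agree only on \<open>inputs d\<close>,
    so the first step of the second chain is restated from \<open>K m\<close>.\<close>
  have junction: "call_step d (K m) (L (Suc 0))" if "0 < n"
    using call_step_cong[OF L(1)[OF that]] L(2) K(3) by simp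
  show ?thesis
  proof (rule callsI[of _ d "\<lambda>j. if j \<le> m then K j else L (j - m)"])
    fix j assume "j < m + n"
    then consider "j < m" | "j = m" "0 < n" | "m < j" "j - m < n" by linarith
    then show "call_step d (if j \<le> m then K j else L (j - m)) (if Suc j \<le> m then K (Suc j) else L (Suc j - m))"
    proof cases
      case 3
      then show ?thesis using L(1)[of "j - m"] by (simp add: Suc_diff_le)
    qed (use K(1) junction in auto)
  qed (use K L in auto)
qed

lemma calls_phase:
  assumes "calls d n G H"
  shows "calls d n (\<lambda>x y. p x * cnj (p y) * G x y) (\<lambda>x y. p x * cnj (p y) * H x y)"
proof -
  obtain K where "\<And>j. j < n \<Longrightarrow> call_step d (K j) (K (Suc j))"
    "\<And>x y. x \<in> inputs d \<Longrightarrow> y \<in> inputs d \<Longrightarrow> K 0 x y = G x y"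
    "\<And>x y. x \<in> inputs d \<Longrightarrow> y \<in> inputs d \<Longrightarrow> K n x y = H x y"
    using callsE[OF assms] by metis
  then show ?thesis
    by (intro callsI[of n d "\<lambda>j x y. p x * cnj (p y) * K j x y"]) (simp_all add: call_step_phase)
qed

lemma calls_scale:
  assumes "calls d n G H" "r \<ge> 0"
  shows "calls d n (\<lambda>x y. complex_of_real r * G x y) (\<lambda>x y. complex_of_real r * H x y)"
  using calls_phase[OF assms(1), of "\<lambda>_. complex_of_real (sqrt r)"] assms(2)
  by (simp flip: of_real_mult)

subsection \<open>The conjugate unitary from antisymmetric states\<close>

text \<open>
  With \<open>j = 0\<close>, the determinants, as functions of \<open>l\<close>, are antisymmetric states of \<open>d - 1\<close> slots that encode
  the basis vector \<open>e\<^sub>b\<close> of the conjugate representation; calls have been made in the slots \<open>l 0, \<dots>, l (j - 1)\<close>.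
\<close>

definition slater_mat :: "nat \<Rightarrow> complex mat \<Rightarrow> nat \<Rightarrow> nat \<Rightarrow> (nat \<Rightarrow> nat) \<Rightarrow> complex mat" where
  "slater_mat d U j b l = mat d d (\<lambda>(t, q).
     if t = 0 then (if q = b then 1 else 0)
     else if t \<le> j then U $$ (l (t - 1), q)
     else (if q = l (t - 1) then 1 else 0))"

lemma slater_mat_carrier [simp]: "slater_mat d U j b l \<in> carrier_mat d d"
  by (simp add: slater_mat_def)

text \<open>The determinant is linear in row \<open>Suc j\<close>, and the rows \<open>e_q\<close>
  weighted by \<open>U $$ (i, q)\<close> add up to row \<open>i\<close> of \<open>U\<close>.\<close>

lemma det_slater_mat_call:
  assumes j: "Suc j < d"
  shows "(\<Sum>q<d. U $$ (i, q) * det (slater_mat d U j b (l(j := q))))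
    = det (slater_mat d U (Suc j) b (l(j := i)))"
proof -
  let ?M = "slater_mat d U (Suc j) b (l(j := i))"
  let ?A = "\<lambda>q. slater_mat d U j b (l(j := q))"
  have del: "mat_delete (?A q) (Suc j) q' = mat_delete ?M (Suc j) q'" for q q'
    by (rule eq_matI) (auto simp: mat_delete_def slater_mat_def)
  have cof: "cofactor (?A q) (Suc j) q' = cofactor ?M (Suc j) q'" for q q'
    by (simp add: cofactor_def del)
  have "det (?A q) = cofactor ?M (Suc j) q" if q: "q < d" for q
  proof -
    have "det (?A q) = (\<Sum>q'<d. ?A q $$ (Suc j, q') * cofactor (?A q) (Suc j) q')"
      by (rule laplace_expansion_row[OF slater_mat_carrier j])
    also have "\<dots> = (\<Sum>q'<d. if q' = q then cofactor ?M (Suc j) q else 0)"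
      using j unfolding cof by (intro sum.cong) (auto simp: slater_mat_def[of d U j])
    finally show ?thesis using q by simp
  qed
  then have "(\<Sum>q<d. U $$ (i, q) * det (?A q)) = (\<Sum>q<d. ?M $$ (Suc j, q) * cofactor ?M (Suc j) q)"
    using j by (intro sum.cong) (auto simp: slater_mat_def[of d U "Suc j"])
  also have "\<dots> = det ?M"
    by (rule laplace_expansion_row[OF slater_mat_carrier j, symmetric])
  finally show ?thesis .
qed

text \<open>The slots carry the minors of \<open>U\<close>; for a unitary \<open>U\<close> these are the entries of the complex conjugate
  up to the factor \<open>det U\<close>.\<close>

lemma det_slater_mat_unitary:
  assumes U: "unitary_op d U" and d: "0 < d" and b: "b < d" and l: "\<And>t. t < d - 1 \<Longrightarrow> l t < d"
  shows "det (slater_mat d U (d - 1) b l)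
    = det U * (\<Sum>b'<d. cnj (U $$ (b', b)) * det (slater_mat d U 0 b' l))"
proof -
  note Uc = unitary_opD(1)[OF U]
  \<comment> \<open>Factoring \<open>U\<close> out on the right turns the rows of \<open>U\<close>
    back into unit vectors, while unitarity turns row 0 into the conjugated column \<open>b\<close>.
    Expanding \<open>det R\<close> along that row gives the sum.\<close>
  define R where "R = mat d d (\<lambda>(t, q). if t = 0 then cnj (U $$ (q, b)) else (if q = l (t - 1) then 1 else 0))"
  have R: "R \<in> carrier_mat d d" by (simp add: R_def)
  have "slater_mat d U (d - 1) b l = R * U"
  proof (rule eq_matI)
    fix t q assume "t < dim_row (R * U)" "q < dim_col (R * U)"
    then have t: "t < d" and q: "q < d" using R Uc by auto
    have RU: "(R * U) $$ (t, q) = (\<Sum>k<d. R $$ (t, k) * U $$ (k, q))"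
      using t q R Uc by (auto simp: scalar_prod_def atLeast0LessThan)
    show "slater_mat d U (d - 1) b l $$ (t, q) = (R * U) $$ (t, q)"
    proof (cases "t = 0")
      case True
      then have "(R * U) $$ (t, q) = (\<Sum>k<d. U $$ (k, q) * cnj (U $$ (k, b)))"
        unfolding RU using t by (intro sum.cong) (auto simp: R_def)
      then show ?thesis using True t q b unitary_op_col_sum[OF U q b] by (auto simp: slater_mat_def)
    next
      case False
      then have lt: "l (t - 1) < d" using l t by simp
      from False have "(R * U) $$ (t, q) = (\<Sum>k<d. if k = l (t - 1) then U $$ (k, q) else 0)"
        unfolding RU using t by (intro sum.cong) (auto simp: R_def)
      then show ?thesis using False t q lt by (simp add: slater_mat_def)
    qed
  qed (use R Uc in \<open>auto simp: slater_mat_def\<close>)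
  then have "det (slater_mat d U (d - 1) b l) = det U * det R"
    using det_mult[OF R Uc] by simp
  moreover have "det R = (\<Sum>b'<d. cnj (U $$ (b', b)) * det (slater_mat d U 0 b' l))"
  proof -
    have del: "mat_delete (slater_mat d U 0 b' l) 0 q = mat_delete R 0 q" for b' q
      by (rule eq_matI) (auto simp: mat_delete_def slater_mat_def R_def)
    have "det (slater_mat d U 0 b' l) = cofactor R 0 b'" if "b' < d" for b'
    proof -
      have "det (slater_mat d U 0 b' l)
          = (\<Sum>q<d. slater_mat d U 0 b' l $$ (0, q) * cofactor (slater_mat d U 0 b' l) 0 q)"
        by (rule laplace_expansion_row[OF slater_mat_carrier d])
      also have "\<dots> = (\<Sum>q<d. if q = b' then cofactor R 0 b' else 0)"
        using d by (intro sum.cong) (auto simp: cofactor_def del, auto simp: slater_mat_def)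
      finally show ?thesis using that by simp
    qed
    then show ?thesis
      unfolding laplace_expansion_row[OF R d] using d by (intro sum.cong) (auto simp: R_def)
  qed
  ultimately show ?thesis by simp
qed

section \<open>Norms and orthogonality of the antisymmetric states\<close>

lemma slater_mat_0_indep: "slater_mat d U 0 b l = slater_mat d V 0 b l"
  by (rule eq_matI) (auto simp: slater_mat_def)

abbreviation slots :: "nat \<Rightarrow> (nat \<Rightarrow> nat) set" where
  "slots d \<equiv> PiE {..<d - 1} (\<lambda>_. {..<d})"

text \<open>The value is the factorial of \<open>d - 1\<close>: the labels that contribute are the
  injective ones avoiding 0, each with a determinant of modulus 1.\<close>

definition slater_norm :: "nat \<Rightarrow> real" where
  "slater_norm d = (\<Sum>l\<in>slots d. (cmod (det (slater_mat d (1\<^sub>m d) 0 0 l)))\<^sup>2)"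

lemma finite_slots [simp]: "finite (slots d)"
  by (intro finite_PiE) auto

lemma slater_norm_pos:
  assumes d: "0 < d"
  shows "slater_norm d > 0"
proof -
  \<comment> \<open>For this label the matrix is the identity, which makes one summand
    positive.\<close>
  define l where "l = restrict Suc {..<d - 1}"
  have l: "l \<in> slots d" unfolding l_def by (rule restrict_PiE_iff[THEN iffD2]) auto
  have lt: "l (t - 1) = t" if "t < d" "t \<noteq> 0" for t
  proof -
    have "t - 1 < d - 1" using that by linarith
    then show ?thesis using that by (simp add: l_def)
  qed
  have "slater_mat d (1\<^sub>m d) 0 0 l = 1\<^sub>m d"
  proof (rule eq_matI)
    fix t q assume "t < dim_row (1\<^sub>m d :: complex mat)" "q < dim_col (1\<^sub>m d :: complex mat)"
    then show "slater_mat d (1\<^sub>m d) 0 0 l $$ (t, q) = 1\<^sub>m d $$ (t, q)"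
      using lt[of t] by (auto simp: slater_mat_def)
  qed (auto simp: slater_mat_def)
  then have "0 < (cmod (det (slater_mat d (1\<^sub>m d) 0 0 l)))\<^sup>2" by simp
  then show ?thesis
    unfolding slater_norm_def by (rule sum_pos2[OF finite_slots l]) simp
qed

lemma slater_mat_row:
  assumes "t < d" "0 < t"
  shows "row (slater_mat d U 0 b l) t = vec d (\<lambda>q. if q = l (t - 1) then 1 else 0)"
  using assms by (intro eq_vecI) (auto simp: slater_mat_def)

lemma slater_mat_row_0:
  assumes "0 < d"
  shows "row (slater_mat d U 0 b l) 0 = vec d (\<lambda>q. if q = b then 1 else 0)"
  using assms by (intro eq_vecI) (auto simp: slater_mat_def)

text \<open>A nonzero determinant has no repeated row. If both were nonzero, \<open>b\<close>,
  \<open>b'\<close> and the \<open>d - 1\<close> slot values would be \<open>d + 1\<close> distinct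
  numbers below \<open>d\<close>.\<close>

lemma slater_orthogonal:
  assumes d: "0 < d" and b: "b < d" "b' < d" "b \<noteq> b'" and l: "l \<in> slots d"
  shows "det (slater_mat d U 0 b l) * cnj (det (slater_mat d U 0 b' l)) = 0"
proof (rule ccontr)
  assume nz: "det (slater_mat d U 0 b l) * cnj (det (slater_mat d U 0 b' l)) \<noteq> 0"
  have notin: "b0 \<notin> l ` {..<d - 1}" if "det (slater_mat d U 0 b0 l) \<noteq> 0" for b0
  proof
    assume "b0 \<in> l ` {..<d - 1}"
    then obtain t where t: "t < d - 1" "l t = b0" by auto
    then have "row (slater_mat d U 0 b0 l) 0 = row (slater_mat d U 0 b0 l) (Suc t)"
      using d by (simp add: slater_mat_row slater_mat_row_0)
    then have "det (slater_mat d U 0 b0 l) = 0"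
      using d t by (intro det_identical_rows[OF slater_mat_carrier, of 0 "Suc t"]) auto
    with that show False by simp
  qed
  have inj: "inj_on l {..<d - 1}"
  proof (rule inj_onI, rule ccontr)
    fix s t assume st: "s \<in> {..<d - 1}" "t \<in> {..<d - 1}" "l s = l t" "s \<noteq> t"
    then have "row (slater_mat d U 0 b l) (Suc s) = row (slater_mat d U 0 b l) (Suc t)"
      by (simp add: slater_mat_row)
    then have "det (slater_mat d U 0 b l) = 0"
      using st by (intro det_identical_rows[OF slater_mat_carrier, of "Suc s" "Suc t"]) auto
    with nz show False by simp
  qed
  have "insert b (insert b' (l ` {..<d - 1})) \<subseteq> {..<d}" using b l by auto
  then have "card (insert b (insert b' (l ` {..<d - 1}))) \<le> d"
    using card_mono[of "{..<d}"] by fastforce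
  moreover have "card (insert b (insert b' (l ` {..<d - 1}))) = Suc (Suc (d - 1))"
    using notin nz b(3) inj by (simp add: card_image)
  ultimately show False by simp
qed

text \<open>Exchanging the labels 0 and \<open>b\<close> permutes the slot values and multiplies the
  matrix by \<open>Q\<close> with \<open>Q * Q = 1\<close>, which leaves the modulus of the
  determinant unchanged.\<close>

lemma slater_norm_eq:
  assumes b: "b < d"
  shows "(\<Sum>l\<in>slots d. (cmod (det (slater_mat d U 0 b l)))\<^sup>2) = slater_norm d"
proof -
  define \<tau> where "\<tau> = Transposition.transpose 0 b"
  have \<tau>d: "\<tau> q < d" if "q < d" for q using that b by (auto simp: \<tau>_def transpose_def)
  have \<tau>\<tau>: "\<tau> (\<tau> q) = q" for q by (simp add: \<tau>_def)
  define Q where "Q = mat d d (\<lambda>(q, q'). if \<tau> q = q' then (1::complex) else 0)"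
  have Q: "Q \<in> carrier_mat d d" by (simp add: Q_def)
  have "Q * Q = 1\<^sub>m d"
  proof (rule eq_matI)
    fix i j assume "i < dim_row (1\<^sub>m d :: complex mat)" "j < dim_col (1\<^sub>m d :: complex mat)"
    then have ij: "i < d" "j < d" by auto
    then have "(Q * Q) $$ (i, j) = (\<Sum>k<d. Q $$ (i, k) * Q $$ (k, j))"
      using Q by (auto simp: scalar_prod_def atLeast0LessThan)
    also have "\<dots> = (\<Sum>k<d. if k = \<tau> i then (if i = j then 1 else 0) else 0)"
      using ij by (intro sum.cong) (auto simp: Q_def \<tau>\<tau>)
    finally have "(Q * Q) $$ (i, j) = (\<Sum>k<d. if k = \<tau> i then (if i = j then 1 else 0) else 0)" .
    then show "(Q * Q) $$ (i, j) = 1\<^sub>m d $$ (i, j)" using ij \<tau>d[of i] by simp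
  qed (use Q in auto)
  then have "det Q * det Q = 1" using det_mult[OF Q Q] by simp
  then have "(cmod (det Q))\<^sup>2 = 1" by (metis norm_mult norm_one power2_eq_square)
  have eq: "(cmod (det (slater_mat d U 0 b (restrict (\<tau> \<circ> l) {..<d - 1}))))\<^sup>2
      = (cmod (det (slater_mat d (1\<^sub>m d) 0 0 l)))\<^sup>2" if l: "l \<in> slots d" for l
  proof -
    have "slater_mat d U 0 b (restrict (\<tau> \<circ> l) {..<d - 1}) = slater_mat d (1\<^sub>m d) 0 0 l * Q"
    proof (rule eq_matI)
      fix t q assume "t < dim_row (slater_mat d (1\<^sub>m d) 0 0 l * Q)" "q < dim_col (slater_mat d (1\<^sub>m d) 0 0 l * Q)"
      then have tq: "t < d" "q < d" using Q by (auto simp: slater_mat_def)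
      define r where "r = (if t = 0 then 0 else l (t - 1))"
      have r: "r < d"
      proof (cases "t = 0")
        case False
        then have "t - 1 \<in> {..<d - 1}" using tq by simp
        from PiE_mem[OF l this] False show ?thesis by (simp add: r_def)
      qed (use b in \<open>simp add: r_def\<close>)
      have sl: "slater_mat d (1\<^sub>m d) 0 0 l $$ (t, k) = (if k = r then 1 else 0)" if "k < d" for k
        using that tq by (cases "t = 0") (simp_all add: slater_mat_def r_def)
      have "(slater_mat d (1\<^sub>m d) 0 0 l * Q) $$ (t, q)
          = (\<Sum>k<d. slater_mat d (1\<^sub>m d) 0 0 l $$ (t, k) * Q $$ (k, q))"
        using tq Q carrier_matD[OF slater_mat_carrier[of d "1\<^sub>m d" 0 0 l]]
        by (simp add: scalar_prod_def atLeast0LessThan)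
      also have "\<dots> = (\<Sum>k<d. if k = r then (if \<tau> r = q then 1 else 0) else 0)"
        using tq by (intro sum.cong) (simp_all add: sl Q_def)
      also have "\<dots> = (if \<tau> r = q then 1 else 0)" using r by simp
      also have "\<dots> = slater_mat d U 0 b (restrict (\<tau> \<circ> l) {..<d - 1}) $$ (t, q)"
      proof (cases "t = 0")
        case True
        then have "\<tau> r = b" by (simp add: r_def \<tau>_def)
        with True show ?thesis using tq by (auto simp: slater_mat_def)
      next
        case False
        have "t - 1 < d - 1" using False tq by linarith
        with False have "restrict (\<tau> \<circ> l) {..<d - 1} (t - 1) = \<tau> r" by (simp add: r_def)
        then have "slater_mat d U 0 b (restrict (\<tau> \<circ> l) {..<d - 1}) $$ (t, q) = (if q = \<tau> r then 1 else 0)"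
          using False tq by (simp only: slater_mat_def index_mat prod.case if_False le_zero_eq)
        then show ?thesis by auto
      qed
      finally show "slater_mat d U 0 b (restrict (\<tau> \<circ> l) {..<d - 1}) $$ (t, q)
          = (slater_mat d (1\<^sub>m d) 0 0 l * Q) $$ (t, q)" ..
    qed (use Q in \<open>auto simp: slater_mat_def\<close>)
    then show ?thesis
      using det_mult[OF slater_mat_carrier Q] \<open>(cmod (det Q))\<^sup>2 = 1\<close>
      by (simp add: norm_mult power_mult_distrib)
  qed
  have "bij_betw (\<lambda>l. restrict (\<tau> \<circ> l) {..<d - 1}) (slots d) (slots d)"
    by (rule bij_betw_byWitness[where f' = "\<lambda>l. restrict (\<tau> \<circ> l) {..<d - 1}"])
      (auto simp: \<tau>\<tau> \<tau>d PiE_def Pi_iff extensional_def fun_eq_iff)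
  from sum.reindex_bij_betw[OF this, symmetric] show ?thesis
    unfolding slater_norm_def using eq by (metis (no_types, lifting) sum.cong)
qed

lemma slater_gram:
  assumes d: "0 < d" and b: "b < d" "b' < d"
  shows "(\<Sum>l\<in>slots d. det (slater_mat d U 0 b l) * cnj (det (slater_mat d V 0 b' l)))
    = (if b = b' then complex_of_real (slater_norm d) else 0)"
proof (cases "b = b'")
  case True
  then show ?thesis
    unfolding slater_mat_0_indep[of d V b' _ U] slater_norm_eq[OF b(1), of U, symmetric]
    by (simp add: complex_norm_square of_real_sum del: of_real_power)
next
  case False
  then show ?thesis
    unfolding slater_mat_0_indep[of d V b' _ U]
    using slater_orthogonal[OF d b] by (simp add: sum.neutral)
qed

text \<open>Isolates slot \<open>j\<close> as the system the call acts on; the other slots become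
  part of the ancilla label.\<close>

lemma sum_slots_split:
  assumes j: "j < d - 1"
  shows "(\<Sum>l\<in>slots d. F l) = (\<Sum>l\<in>PiE ({..<d - 1} - {j}) (\<lambda>_. {..<d}). \<Sum>i<d. F (l(j := i)))"
proof -
  have "slots d = PiE (insert j ({..<d - 1} - {j})) (\<lambda>_. {..<d})"
    using j by (intro PiE_cong arg_cong2[where f = PiE]) auto
  also have "\<dots> = (\<lambda>(i, l). l(j := i)) ` ({..<d} \<times> PiE ({..<d - 1} - {j}) (\<lambda>_. {..<d}))"
    by (rule PiE_insert_eq)
  finally have "(\<Sum>l\<in>slots d. F l) = (\<Sum>(i, l)\<in>{..<d} \<times> PiE ({..<d - 1} - {j}) (\<lambda>_. {..<d}). F (l(j := i)))"
    using sum.reindex[OF inj_combinator[of j "{..<d - 1} - {j}" "\<lambda>_. {..<d}"], of F]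
    by (simp add: case_prod_unfold comp_def)
  also have "\<dots> = (\<Sum>l\<in>PiE ({..<d - 1} - {j}) (\<lambda>_. {..<d}). \<Sum>i<d. F (l(j := i)))"
    by (subst sum.cartesian_product[symmetric]) (rule sum.swap)
  finally show ?thesis .
qed

text \<open>The register \<open>b\<close> is encoded in \<open>d - 1\<close> antisymmetric slots and
  each slot receives one call. \<open>F j\<close> is the state with the first \<open>j\<close> slots
  called, and \<open>P\<close> labels the systems left untouched.\<close>

lemma calls_conjugate:
  fixes P :: "'p set" and s :: "complex mat \<times> nat \<Rightarrow> 'p \<times> nat \<Rightarrow> complex"
  assumes d: "0 < d" and P: "finite P"
  defines "s' \<equiv> \<lambda>x (p, b'). \<Sum>b<d. s x (p, b) * cnj (fst x $$ (b', b))"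
  shows "calls d (d - 1) (gram (P \<times> {..<d}) s s)
    (\<lambda>x y. det (fst x) * cnj (det (fst y)) * gram (P \<times> {..<d}) s' s' x y)"
proof -
  define F where "F j x = (\<lambda>(p, l). \<Sum>b<d. s x (p, b) * det (slater_mat d (fst x) j b l))" for j x
  have step: "call_step d (gram (P \<times> slots d) (F j) (F j)) (gram (P \<times> slots d) (F (Suc j)) (F (Suc j)))"
    if j: "j < d - 1" for j
  proof -
    define f where "f x = (\<lambda>((p, l), i). F j x (p, l(j := i)))" for x
    let ?L = "PiE ({..<d - 1} - {j}) (\<lambda>_. {..<d})"
    have app: "apply_call d f x ((p, l), i) = F (Suc j) x (p, l(j := i))" for x p l i
    proof -
      have "apply_call d f x ((p, l), i)
          = (\<Sum>q<d. \<Sum>b<d. s x (p, b) * (fst x $$ (i, q) * det (slater_mat d (fst x) j b (l(j := q)))))"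
        by (simp add: apply_call_def f_def F_def sum_distrib_left ac_simps)
      also have "\<dots> = (\<Sum>b<d. s x (p, b) * (\<Sum>q<d. fst x $$ (i, q) * det (slater_mat d (fst x) j b (l(j := q)))))"
        by (subst sum.swap) (simp add: sum_distrib_left)
      finally show ?thesis
        using det_slater_mat_call[of j d "fst x" i _ l] j by (simp add: F_def)
    qed
    show ?thesis
    proof (rule call_stepI[of "P \<times> ?L" _ f])
      show "finite (P \<times> ?L)" using P by (intro finite_cartesian_product finite_PiE) auto
      show "gram ((P \<times> ?L) \<times> {..<d}) f f x y = gram (P \<times> slots d) (F j) (F j) x y" for x y
        unfolding gram_def sum.cartesian_product' sum_slots_split[OF j] by (simp add: f_def)
      show "gram ((P \<times> ?L) \<times> {..<d}) (apply_call d f) (apply_call d f) x y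
          = gram (P \<times> slots d) (F (Suc j)) (F (Suc j)) x y" for x y
        unfolding gram_def sum.cartesian_product' sum_slots_split[OF j] by (simp add: app)
    qed
  qed
  \<comment> \<open>The encoding is isometric up to the factor \<open>slater_norm d\<close>, since
    the encoded basis vectors are orthogonal and of equal norm.\<close>
  have expand: "(\<Sum>l\<in>slots d. (\<Sum>b<d. u b * det (slater_mat d U 0 b l))
        * cnj (\<Sum>b<d. v b * det (slater_mat d V 0 b l)))
      = complex_of_real (slater_norm d) * (\<Sum>b<d. u b * cnj (v b))" for u v U V
  proof -
    have "(\<Sum>l\<in>slots d. (\<Sum>b<d. u b * det (slater_mat d U 0 b l))
        * cnj (\<Sum>b<d. v b * det (slater_mat d V 0 b l)))
      = (\<Sum>l\<in>slots d. \<Sum>b<d. \<Sum>b'<d. u b * cnj (v b')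
          * (det (slater_mat d U 0 b l) * cnj (det (slater_mat d V 0 b' l))))"
      by (simp add: sum_product ac_simps)
    also have "\<dots> = (\<Sum>b<d. \<Sum>l\<in>slots d. \<Sum>b'<d. u b * cnj (v b')
          * (det (slater_mat d U 0 b l) * cnj (det (slater_mat d V 0 b' l))))"
      by (rule sum.swap)
    also have "\<dots> = (\<Sum>b<d. \<Sum>b'<d. \<Sum>l\<in>slots d. u b * cnj (v b')
          * (det (slater_mat d U 0 b l) * cnj (det (slater_mat d V 0 b' l))))"
      by (intro sum.cong refl) (rule sum.swap)
    also have "\<dots> = (\<Sum>b<d. \<Sum>b'<d. if b' = b then u b * cnj (v b) * complex_of_real (slater_norm d) else 0)"
      unfolding sum_distrib_left[symmetric]
      using slater_gram[OF d] by (intro sum.cong refl) auto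
    also have "\<dots> = complex_of_real (slater_norm d) * (\<Sum>b<d. u b * cnj (v b))"
      by (simp add: sum_distrib_left ac_simps)
    finally show ?thesis .
  qed
  have first: "gram (P \<times> slots d) (F 0) (F 0) x y
      = complex_of_real (slater_norm d) * gram (P \<times> {..<d}) s s x y" for x y
    unfolding gram_def sum.cartesian_product' F_def prod.case expand by (simp add: sum_distrib_left)
  have Flast: "F (d - 1) x (p, l) = det (fst x) * (\<Sum>b'<d. s' x (p, b') * det (slater_mat d (fst x) 0 b' l))"
    if "x \<in> inputs d" "l \<in> slots d" for x p l
  proof -
    have U: "unitary_op d (fst x)" using that(1) by (auto simp: inputs_def)
    have "l t < d" if "t < d - 1" for t
      using PiE_mem[OF \<open>l \<in> slots d\<close>, of t] that by simp
    note det = det_slater_mat_unitary[OF U d _ this]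
    have "F (d - 1) x (p, l) = (\<Sum>b<d. s x (p, b) *
        (det (fst x) * (\<Sum>b'<d. cnj (fst x $$ (b', b)) * det (slater_mat d (fst x) 0 b' l))))"
      unfolding F_def prod.case by (intro sum.cong refl) (simp only: det lessThan_iff)
    also have "\<dots> = (\<Sum>b<d. \<Sum>b'<d. det (fst x) *
        (s x (p, b) * cnj (fst x $$ (b', b)) * det (slater_mat d (fst x) 0 b' l)))"
      by (simp add: sum_distrib_left ac_simps)
    also have "\<dots> = det (fst x) * (\<Sum>b'<d. s' x (p, b') * det (slater_mat d (fst x) 0 b' l))"
      by (subst sum.swap) (simp add: s'_def sum_distrib_left sum_distrib_right)
    finally show ?thesis .
  qed
  have last: "gram (P \<times> slots d) (F (d - 1)) (F (d - 1)) x y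
      = complex_of_real (slater_norm d) * (det (fst x) * cnj (det (fst y)) * gram (P \<times> {..<d}) s' s' x y)"
    if "x \<in> inputs d" "y \<in> inputs d" for x y
  proof -
    have "gram (P \<times> slots d) (F (d - 1)) (F (d - 1)) x y
      = (\<Sum>p\<in>P. det (fst x) * cnj (det (fst y)) * (\<Sum>l\<in>slots d.
          (\<Sum>b'<d. s' x (p, b') * det (slater_mat d (fst x) 0 b' l))
          * cnj (\<Sum>b'<d. s' y (p, b') * det (slater_mat d (fst y) 0 b' l))))"
      unfolding gram_def sum.cartesian_product' sum_distrib_left using that
      by (intro sum.cong refl) (simp only: Flast complex_cnj_mult mult_ac)
    then show ?thesis
      unfolding expand gram_def sum.cartesian_product' by (simp add: sum_distrib_left ac_simps)
  qed
  \<comment> \<open>Both end kernels carry the factor \<open>slater_norm d\<close>; its positivity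
    allows dividing the whole chain by it.\<close>
  have inv: "complex_of_real (inverse (slater_norm d)) * (complex_of_real (slater_norm d) * z) = z" for z
    using slater_norm_pos[OF d] by simp
  have "calls d (d - 1) (gram (P \<times> slots d) (F 0) (F 0)) (gram (P \<times> slots d) (F (d - 1)) (F (d - 1)))"
    by (rule callsI[of _ d "\<lambda>j. gram (P \<times> slots d) (F j) (F j)"]) (erule step | rule refl)+
  note scaled = calls_scale[OF this, of "inverse (slater_norm d)"]
  show ?thesis
    by (rule calls_cong[OF scaled]) (use slater_norm_pos[OF d] in \<open>simp_all only: first last inv
        inverse_nonnegative_iff_nonnegative less_imp_le\<close>)
qed

subsection \<open>Kernels of the inversion protocol\<close>

text \<open>
  Gram matrices of the families used below, for \<open>\<psi> = e\<^sub>i\<close> and \<open>\<chi> = U\<^sup>\<dagger> \<psi>\<close>: \<open>input_kernel\<close> belongs to \<open>\<psi>\<close>,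
  \<open>output_kernel\<close> to \<open>\<chi>\<close>, \<open>trace_kernel\<close> to \<open>U\<close> (unnormalised), \<open>idle_kernel\<close> to the normalised part of
  \<open>U\<^sub>A \<Phi>\<^sub>A\<^sub>B \<chi>\<^sub>C\<close> orthogonal to \<open>\<psi>\<^sub>A \<Phi>\<^sub>B\<^sub>C\<close>, and \<open>failure_kernel\<close> to the normalised part of \<open>U\<^sup>*\<^sub>B \<psi>\<^sub>A \<Phi>\<^sub>B\<^sub>C\<close> orthogonal
  to \<open>\<Phi>\<^sub>A\<^sub>B \<chi>\<^sub>C\<close>.
\<close>

definition input_kernel :: "complex mat \<times> nat \<Rightarrow> complex mat \<times> nat \<Rightarrow> complex" where
  "input_kernel x y = (if snd x = snd y then 1 else 0)"

definition output_kernel :: "nat \<Rightarrow> complex mat \<times> nat \<Rightarrow> complex mat \<times> nat \<Rightarrow> complex" where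
  "output_kernel d x y = (\<Sum>c<d. cnj (fst x $$ (snd x, c)) * fst y $$ (snd y, c))"

definition trace_kernel :: "nat \<Rightarrow> complex mat \<times> nat \<Rightarrow> complex mat \<times> nat \<Rightarrow> complex" where
  "trace_kernel d x y = (\<Sum>a<d. \<Sum>b<d. fst x $$ (a, b) * cnj (fst y $$ (a, b)))"

definition idle_kernel :: "nat \<Rightarrow> complex mat \<times> nat \<Rightarrow> complex mat \<times> nat \<Rightarrow> complex" where
  "idle_kernel d x y = complex_of_real (1 / ((real d)\<^sup>2 - 1)) *
    (of_nat d * trace_kernel d x y * output_kernel d x y - input_kernel x y)"

definition failure_kernel :: "nat \<Rightarrow> complex mat \<times> nat \<Rightarrow> complex mat \<times> nat \<Rightarrow> complex" where
  "failure_kernel d x y = complex_of_real (1 / ((real d)\<^sup>2 - 1)) *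
    (of_nat d * cnj (trace_kernel d x y) * input_kernel x y - output_kernel d x y)"

section \<open>Calls that transform the kernels of the protocol\<close>

lemma gram_lincomb:
  "gram I (\<lambda>x a. complex_of_real p * f x a + complex_of_real q * g x a)
      (\<lambda>x a. complex_of_real p * f x a + complex_of_real q * g x a) x y
    = complex_of_real (p\<^sup>2) * gram I f f x y + complex_of_real (p * q) * (gram I f g x y + gram I g f x y)
      + complex_of_real (q\<^sup>2) * gram I g g x y"
  unfolding gram_add_left gram_add_right gram_scale
  by (simp add: algebra_simps power2_eq_square)

lemma apply_call_lincomb:
  "apply_call d (\<lambda>x a. p * f x a + q * g x a) = (\<lambda>x a. p * apply_call d f x a + q * apply_call d g x a)"
  by (auto simp: apply_call_def fun_eq_iff sum_distrib_left sum.distrib algebra_simps)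

lemma inputsD:
  assumes "x \<in> inputs d"
  shows "unitary_op d (fst x)" "snd x < d"
  using assms by (auto simp: inputs_def)

lemma gram_call_stepI:
  fixes A :: "'a set"
  assumes A: "finite A"
    and app: "\<And>x a. x \<in> inputs d \<Longrightarrow> a \<in> A \<times> {..<d} \<Longrightarrow> apply_call d f x a = f' x a"
    "\<And>x a. x \<in> inputs d \<Longrightarrow> a \<in> A \<times> {..<d} \<Longrightarrow> apply_call d g x a = g' x a"
  shows "call_step d
    (\<lambda>x y. complex_of_real (p\<^sup>2) * gram (A \<times> {..<d}) f f x y
      + complex_of_real (p * q) * (gram (A \<times> {..<d}) f g x y + gram (A \<times> {..<d}) g f x y)
      + complex_of_real (q\<^sup>2) * gram (A \<times> {..<d}) g g x y)
    (\<lambda>x y. complex_of_real (p\<^sup>2) * gram (A \<times> {..<d}) f' f' x y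
      + complex_of_real (p * q) * (gram (A \<times> {..<d}) f' g' x y + gram (A \<times> {..<d}) g' f' x y)
      + complex_of_real (q\<^sup>2) * gram (A \<times> {..<d}) g' g' x y)"
proof (rule call_stepI[OF A])
  let ?h = "\<lambda>x a. complex_of_real p * f x a + complex_of_real q * g x a"
  fix x y assume xy: "x \<in> inputs d" "y \<in> inputs d"
  show "gram (A \<times> {..<d}) ?h ?h x y = complex_of_real (p\<^sup>2) * gram (A \<times> {..<d}) f f x y
      + complex_of_real (p * q) * (gram (A \<times> {..<d}) f g x y + gram (A \<times> {..<d}) g f x y)
      + complex_of_real (q\<^sup>2) * gram (A \<times> {..<d}) g g x y"
    by (rule gram_lincomb)
  have "gram (A \<times> {..<d}) (apply_call d ?h) (apply_call d ?h) x y
      = gram (A \<times> {..<d}) (\<lambda>x a. complex_of_real p * f' x a + complex_of_real q * g' x a)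
          (\<lambda>x a. complex_of_real p * f' x a + complex_of_real q * g' x a) x y"
    unfolding apply_call_lincomb unfolding gram_def by (intro sum.cong refl) (simp only: app xy)
  then show "gram (A \<times> {..<d}) (apply_call d ?h) (apply_call d ?h) x y
      = complex_of_real (p\<^sup>2) * gram (A \<times> {..<d}) f' f' x y
      + complex_of_real (p * q) * (gram (A \<times> {..<d}) f' g' x y + gram (A \<times> {..<d}) g' f' x y)
      + complex_of_real (q\<^sup>2) * gram (A \<times> {..<d}) g' g' x y"
    unfolding gram_lincomb .
qed

lemma sum_if_cond:
  "(\<Sum>a<d. (if a = b then f a else 0) :: complex) = (if b < d then f b else 0)"
  "(\<Sum>a<d. (if b = a then f a else 0) :: complex) = (if b < d then f b else 0)"
  for b d :: nat
  by auto

lemma if_zero_distrib: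
  "cnj (if P then z else 0) = (if P then cnj z else 0)"
  "(if P then z else 0) * w = (if P then z * w else 0)"
  "w * (if P then z else 0) = (if P then w * z else 0)"
  by auto

lemma sum_if_indep: "(\<Sum>a\<in>I. (if P then f a else 0) :: complex) = (if P then sum f I else 0)"
  by simp

lemmas gram_simps = gram_def sum.cartesian_product' if_zero_distrib sum_if_cond sum_if_indep

text \<open>A call sends \<chi> back to \<psi>. This gives up success amplitude on purpose, which is
  how the last rotation is made to end exactly at the right angle.\<close>

lemma call_step_output_input: "call_step d (output_kernel d) input_kernel"
proof (rule call_stepI[of "{()}" d "\<lambda>x (_, i). cnj (fst x $$ (snd x, i))"])
  show "gram ({()} \<times> {..<d}) (\<lambda>x (_, i). cnj (fst x $$ (snd x, i))) (\<lambda>x (_, i). cnj (fst x $$ (snd x, i))) x y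
      = output_kernel d x y" for x y :: "complex mat \<times> nat"
    by (simp add: gram_def output_kernel_def sum.cartesian_product')
  fix x y assume xy: "x \<in> inputs d" "y \<in> inputs d"
  have "apply_call d (\<lambda>x (_, i). cnj (fst x $$ (snd x, i))) x ((), i) = (if i = snd x then 1 else 0)"
    if "x \<in> inputs d" "i < d" for x i
    using unitary_op_row_sum[OF inputsD(1)[OF that(1)] that(2) inputsD(2)[OF that(1)]]
    by (simp add: apply_call_def)
  then show "gram ({()} \<times> {..<d}) (apply_call d (\<lambda>x (_, i). cnj (fst x $$ (snd x, i))))
      (apply_call d (\<lambda>x (_, i). cnj (fst x $$ (snd x, i)))) x y = input_kernel x y"
    using xy inputsD[OF xy(1)] by (simp add: gram_simps input_kernel_def)
qed simp

text \<open>The vector \<open>p v\<^sub>1 + q v\<^sub>2\<close> is the normalised projection of \<open>v\<^sub>1\<close> orthogonal to \<open>v\<^sub>2\<close>, for vectors of squared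
  norm \<open>d\<close> with inner product \<open>1\<close>.\<close>

lemma projection_coefficients:
  assumes "2 \<le> (d::nat)"
  obtains p q r :: real where "r = 1 / ((real d)\<^sup>2 - 1)" "p\<^sup>2 = d * r" "p * q = - r" "d * q\<^sup>2 = r"
    "d * p\<^sup>2 + 2 * (p * q) + d * q\<^sup>2 = 1"
proof -
  define r where "r = 1 / ((real d)\<^sup>2 - 1)"
  have "2\<^sup>2 \<le> (real d)\<^sup>2" using assms by (intro power_mono) auto
  then have d2: "(real d)\<^sup>2 - 1 > 0" by simp
  then have r: "r > 0" "r * ((real d)\<^sup>2 - 1) = 1" by (simp_all add: r_def)
  \<comment> \<open>The vector \<open>v1 - v2 / d\<close> has squared norm
    \<open>d - 1 / d = 1 / (d * r)\<close>.\<close>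
  define p where "p = sqrt (d * r)"
  define q where "q = - p / d"
  have p2: "p\<^sup>2 = d * r" using r by (simp add: p_def)
  have pq: "p * q = - r" using p2 assms by (simp add: q_def power2_eq_square)
  have q2: "d * q\<^sup>2 = r" using p2 assms by (simp add: q_def power_divide) (simp add: power2_eq_square)
  have "d * p\<^sup>2 + 2 * (p * q) + d * q\<^sup>2 = r * ((real d)\<^sup>2 - 1)"
    unfolding p2 pq q2 by (simp add: power2_eq_square algebra_simps)
  also have "\<dots> = 1" by (rule r(2))
  finally show ?thesis by (rule that[OF r_def p2 pq q2])
qed

text \<open>Before the call both vectors depend linearly on \<chi>, so their normalised combination
  has the kernel of \<chi>. The call on A turns it into the idle state, as \<open>U\<close> maps
  \<chi> to \<psi>.\<close>

lemma call_step_output_idle: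
  assumes d: "2 \<le> d"
  shows "call_step d (output_kernel d) (idle_kernel d)"
proof -
  \<comment> \<open>Up to normalisation \<open>\<Phi>\<^sub>A\<^sub>B \<chi>\<^sub>C\<close>, \<open>\<chi>\<^sub>A \<Phi>\<^sub>B\<^sub>C\<close> and their images under \<open>U\<^sub>A\<close>.\<close>
  define v1 :: "complex mat \<times> nat \<Rightarrow> (nat \<times> nat) \<times> nat \<Rightarrow> complex"
    where "v1 x = (\<lambda>((b, c), a). if a = b then cnj (fst x $$ (snd x, c)) else 0)" for x
  define v2 :: "complex mat \<times> nat \<Rightarrow> (nat \<times> nat) \<times> nat \<Rightarrow> complex"
    where "v2 x = (\<lambda>((b, c), a). if b = c then cnj (fst x $$ (snd x, a)) else 0)" for x
  define v3 :: "complex mat \<times> nat \<Rightarrow> (nat \<times> nat) \<times> nat \<Rightarrow> complex"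
    where "v3 x = (\<lambda>((b, c), a). fst x $$ (a, b) * cnj (fst x $$ (snd x, c)))" for x
  define v4 :: "complex mat \<times> nat \<Rightarrow> (nat \<times> nat) \<times> nat \<Rightarrow> complex"
    where "v4 x = (\<lambda>((b, c), a). if b = c then if a = snd x then 1 else 0 else 0)" for x
  let ?A = "{..<d} \<times> {..<d}"
  let ?G = "gram (?A \<times> {..<d})"
  obtain p q r :: real where pqr: "r = 1 / ((real d)\<^sup>2 - 1)" "p\<^sup>2 = d * r" "p * q = - r" "d * q\<^sup>2 = r"
    "d * p\<^sup>2 + 2 * (p * q) + d * q\<^sup>2 = 1"
    using projection_coefficients[OF d] by metis
  have app: "apply_call d v1 x a = v3 x a" "apply_call d v2 x a = v4 x a"
    if "x \<in> inputs d" "a \<in> ?A \<times> {..<d}" for x a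
    using that unitary_op_row_sum[OF inputsD(1)[OF that(1)] _ inputsD(2)[OF that(1)]]
    by (auto simp: apply_call_def v1_def v2_def v3_def v4_def gram_simps cong: if_cong)
  have pre: "?G v1 v1 x y = d * output_kernel d x y" "?G v1 v2 x y = output_kernel d x y"
    "?G v2 v1 x y = output_kernel d x y" "?G v2 v2 x y = d * output_kernel d x y" for x y
    by (simp_all add: v1_def v2_def output_kernel_def gram_simps sum_distrib_left cong: if_cong)
  have post: "?G v3 v3 x y = trace_kernel d x y * output_kernel d x y" "?G v3 v4 x y = input_kernel x y"
    "?G v4 v3 x y = input_kernel x y" "?G v4 v4 x y = d * input_kernel x y"
    if "x \<in> inputs d" "y \<in> inputs d" for x y
  proof -
    have "?G v3 v3 x y = (\<Sum>b<d. \<Sum>c<d. \<Sum>a<d. (fst x $$ (a, b) * cnj (fst y $$ (a, b)))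
        * (cnj (fst x $$ (snd x, c)) * fst y $$ (snd y, c)))"
      by (simp add: gram_def sum.cartesian_product' v3_def ac_simps)
    also have "\<dots> = (\<Sum>b<d. \<Sum>a<d. fst x $$ (a, b) * cnj (fst y $$ (a, b))) * output_kernel d x y"
      unfolding output_kernel_def sum_distrib_right[symmetric] sum_distrib_left[symmetric] ..
    also have "(\<Sum>b<d. \<Sum>a<d. fst x $$ (a, b) * cnj (fst y $$ (a, b))) = trace_kernel d x y"
      unfolding trace_kernel_def by (rule sum.swap)
    finally show "?G v3 v3 x y = trace_kernel d x y * output_kernel d x y" .
    show "?G v3 v4 x y = input_kernel x y" "?G v4 v3 x y = input_kernel x y" "?G v4 v4 x y = d * input_kernel x y"
      using that[THEN inputsD(2)] unitary_op_row_sum[OF inputsD(1)[OF that(1)]]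
        unitary_op_row_sum[OF inputsD(1)[OF that(2)]]
      by (simp_all add: v3_def v4_def input_kernel_def gram_simps mult.commute cong: if_cong)
  qed
  show ?thesis
  proof (rule call_step_cong[OF gram_call_stepI[where p = p and q = q and A = ?A, OF _ app]])
    fix x y assume xy: "x \<in> inputs d" "y \<in> inputs d"
    have "complex_of_real (p\<^sup>2) * ?G v1 v1 x y + complex_of_real (p * q) * (?G v1 v2 x y + ?G v2 v1 x y)
        + complex_of_real (q\<^sup>2) * ?G v2 v2 x y
      = complex_of_real (d * p\<^sup>2 + 2 * (p * q) + d * q\<^sup>2) * output_kernel d x y"
      unfolding pre by (simp add: algebra_simps)
    then show "complex_of_real (p\<^sup>2) * ?G v1 v1 x y + complex_of_real (p * q) * (?G v1 v2 x y + ?G v2 v1 x y)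
        + complex_of_real (q\<^sup>2) * ?G v2 v2 x y = output_kernel d x y"
      unfolding pqr(5) by simp
    have "complex_of_real (p\<^sup>2) * ?G v3 v3 x y + complex_of_real (p * q) * (?G v3 v4 x y + ?G v4 v3 x y)
        + complex_of_real (q\<^sup>2) * ?G v4 v4 x y
      = complex_of_real (p\<^sup>2) * (trace_kernel d x y * output_kernel d x y)
        + complex_of_real (2 * (p * q) + d * q\<^sup>2) * input_kernel x y"
      unfolding post[OF xy] by (simp add: algebra_simps)
    also have "\<dots> = idle_kernel d x y"
      unfolding pqr(2-4) idle_kernel_def pqr(1)[symmetric] by (simp add: algebra_simps)
    finally show "complex_of_real (p\<^sup>2) * ?G v3 v3 x y + complex_of_real (p * q) * (?G v3 v4 x y + ?G v4 v3 x y)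
        + complex_of_real (q\<^sup>2) * ?G v4 v4 x y = idle_kernel d x y" .
  qed auto
qed

text \<open>The failure state can be written with its dependence on \<open>U\<close> entirely in
  system C, as an inverse of \<open>U\<close> there. A call on C cancels it and leaves vectors that
  depend on \<psi> alone.\<close>

lemma call_step_failure_input:
  assumes d: "2 \<le> d"
  shows "call_step d (failure_kernel d) input_kernel"
proof -
  \<comment> \<open>Up to normalisation \<open>U\<^sup>*\<^sub>B \<psi>\<^sub>A \<Phi>\<^sub>B\<^sub>C = U\<^sup>\<dagger>\<^sub>C \<psi>\<^sub>A \<Phi>\<^sub>B\<^sub>C\<close>, \<open>\<Phi>\<^sub>A\<^sub>B \<chi>\<^sub>C\<close> and their images under \<open>U\<^sub>C\<close>.\<close>
  define v1 :: "complex mat \<times> nat \<Rightarrow> (nat \<times> nat) \<times> nat \<Rightarrow> complex"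
    where "v1 x = (\<lambda>((a, b), c). if a = snd x then cnj (fst x $$ (b, c)) else 0)" for x
  define v2 :: "complex mat \<times> nat \<Rightarrow> (nat \<times> nat) \<times> nat \<Rightarrow> complex"
    where "v2 x = (\<lambda>((a, b), c). if a = b then cnj (fst x $$ (snd x, c)) else 0)" for x
  define v3 :: "complex mat \<times> nat \<Rightarrow> (nat \<times> nat) \<times> nat \<Rightarrow> complex"
    where "v3 x = (\<lambda>((a, b), c). if a = snd x then if b = c then 1 else 0 else 0)" for x
  define v4 :: "complex mat \<times> nat \<Rightarrow> (nat \<times> nat) \<times> nat \<Rightarrow> complex"
    where "v4 x = (\<lambda>((a, b), c). if a = b then if c = snd x then 1 else 0 else 0)" for x
  let ?A = "{..<d} \<times> {..<d}"
  let ?G = "gram (?A \<times> {..<d})"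
  obtain p q r :: real where pqr: "r = 1 / ((real d)\<^sup>2 - 1)" "p\<^sup>2 = d * r" "p * q = - r" "d * q\<^sup>2 = r"
    "d * p\<^sup>2 + 2 * (p * q) + d * q\<^sup>2 = 1"
    using projection_coefficients[OF d] by metis
  have app: "apply_call d v1 x a = v3 x a" "apply_call d v2 x a = v4 x a"
    if "x \<in> inputs d" "a \<in> ?A \<times> {..<d}" for x a
    using that unitary_op_row_sum[OF inputsD(1)[OF that(1)]] inputsD(2)[OF that(1)]
    by (auto simp: apply_call_def v1_def v2_def v3_def v4_def gram_simps cong: if_cong)
  have pre: "?G v1 v1 x y = cnj (trace_kernel d x y) * input_kernel x y" "?G v1 v2 x y = output_kernel d x y"
    "?G v2 v1 x y = output_kernel d x y" "?G v2 v2 x y = d * output_kernel d x y"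
    and post: "?G v3 v3 x y = d * input_kernel x y" "?G v3 v4 x y = input_kernel x y"
    "?G v4 v3 x y = input_kernel x y" "?G v4 v4 x y = d * input_kernel x y"
    if "x \<in> inputs d" "y \<in> inputs d" for x y
    using that[THEN inputsD(2)]
    by (simp_all add: v1_def v2_def v3_def v4_def output_kernel_def trace_kernel_def input_kernel_def
        gram_simps sum_distrib_left cong: if_cong)
  show ?thesis
  proof (rule call_step_cong[OF gram_call_stepI[where p = p and q = q and A = ?A, OF _ app]])
    fix x y assume xy: "x \<in> inputs d" "y \<in> inputs d"
    have "complex_of_real (p\<^sup>2) * ?G v3 v3 x y + complex_of_real (p * q) * (?G v3 v4 x y + ?G v4 v3 x y)
        + complex_of_real (q\<^sup>2) * ?G v4 v4 x y
      = complex_of_real (d * p\<^sup>2 + 2 * (p * q) + d * q\<^sup>2) * input_kernel x y"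
      unfolding post[OF xy] by (simp add: algebra_simps)
    then show "complex_of_real (p\<^sup>2) * ?G v3 v3 x y + complex_of_real (p * q) * (?G v3 v4 x y + ?G v4 v3 x y)
        + complex_of_real (q\<^sup>2) * ?G v4 v4 x y = input_kernel x y"
      unfolding pqr(5) by simp
    have "complex_of_real (p\<^sup>2) * ?G v1 v1 x y + complex_of_real (p * q) * (?G v1 v2 x y + ?G v2 v1 x y)
        + complex_of_real (q\<^sup>2) * ?G v2 v2 x y
      = complex_of_real (p\<^sup>2) * (cnj (trace_kernel d x y) * input_kernel x y)
        + complex_of_real (2 * (p * q) + d * q\<^sup>2) * output_kernel d x y"
      unfolding pre[OF xy] by (simp add: algebra_simps)
    also have "\<dots> = failure_kernel d x y"
      unfolding pqr(2-4) failure_kernel_def pqr(1)[symmetric] by (simp add: algebra_simps)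
    finally show "complex_of_real (p\<^sup>2) * ?G v1 v1 x y + complex_of_real (p * q) * (?G v1 v2 x y + ?G v2 v1 x y)
        + complex_of_real (q\<^sup>2) * ?G v2 v2 x y = failure_kernel d x y" .
  qed auto
qed

text \<open>Since \<open>U\<close> on A together with its conjugate on B fixes \<Phi>, the second
  vector becomes \<Phi> on AB times \<chi> on C. The cross terms carry \<open>input_kernel\<close>
  before the calls and \<open>output_kernel\<close> after them; this is the interference.\<close>

lemma calls_conjugate_pair:
  fixes p q :: real
  assumes d: "0 < d"
  shows "calls d (d - 1)
    (\<lambda>x y. complex_of_real (d * p\<^sup>2 + 2 * (p * q)) * input_kernel x y
      + complex_of_real (q\<^sup>2) * (trace_kernel d x y * output_kernel d x y))
    (\<lambda>x y. det (fst x) * cnj (det (fst y)) *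
      (complex_of_real (p\<^sup>2) * (cnj (trace_kernel d x y) * input_kernel x y)
       + complex_of_real (2 * (p * q) + d * q\<^sup>2) * output_kernel d x y))"
proof -
  \<comment> \<open>Up to normalisation \<open>\<psi>\<^sub>A \<Phi>\<^sub>B\<^sub>C\<close>, \<open>U\<^sub>A \<Phi>\<^sub>A\<^sub>B \<chi>\<^sub>C\<close> and their images under \<open>U\<^sup>*\<^sub>B\<close>.\<close>
  define v1 :: "complex mat \<times> nat \<Rightarrow> (nat \<times> nat) \<times> nat \<Rightarrow> complex"
    where "v1 x = (\<lambda>((a, c), b). if a = snd x then if c = b then 1 else 0 else 0)" for x
  define v2 :: "complex mat \<times> nat \<Rightarrow> (nat \<times> nat) \<times> nat \<Rightarrow> complex"
    where "v2 x = (\<lambda>((a, c), b). fst x $$ (a, b) * cnj (fst x $$ (snd x, c)))" for x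
  define v3 :: "complex mat \<times> nat \<Rightarrow> (nat \<times> nat) \<times> nat \<Rightarrow> complex"
    where "v3 x = (\<lambda>((a, c), b). if a = snd x then cnj (fst x $$ (b, c)) else 0)" for x
  define v4 :: "complex mat \<times> nat \<Rightarrow> (nat \<times> nat) \<times> nat \<Rightarrow> complex"
    where "v4 x = (\<lambda>((a, c), b). if a = b then cnj (fst x $$ (snd x, c)) else 0)" for x
  let ?A = "{..<d} \<times> {..<d}"
  let ?G = "gram (?A \<times> {..<d})"
  let ?s = "\<lambda>x a. complex_of_real p * v1 x a + complex_of_real q * v2 x a"
  let ?s' = "\<lambda>x a. complex_of_real p * v3 x a + complex_of_real q * v4 x a"
  have conj: "(case a of (c, b') \<Rightarrow> \<Sum>b<d. ?s x (c, b) * cnj (fst x $$ (b', b))) = ?s' x a"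
    if x: "x \<in> inputs d" and a: "a \<in> ?A \<times> {..<d}" for x a
  proof -
    obtain a1 c b where abc: "a = ((a1, c), b)" "a1 < d" "c < d" "b < d" using a by auto
    have "(\<Sum>k<d. ?s x ((a1, c), k) * cnj (fst x $$ (b, k)))
      = complex_of_real p * (\<Sum>k<d. v1 x ((a1, c), k) * cnj (fst x $$ (b, k)))
        + complex_of_real q * (\<Sum>k<d. v2 x ((a1, c), k) * cnj (fst x $$ (b, k)))"
      by (simp add: sum_distrib_left sum.distrib algebra_simps)
    also have "(\<Sum>k<d. v1 x ((a1, c), k) * cnj (fst x $$ (b, k))) = v3 x a"
      using abc by (simp add: v1_def v3_def gram_simps cong: if_cong)
    also have "(\<Sum>k<d. v2 x ((a1, c), k) * cnj (fst x $$ (b, k)))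
        = (\<Sum>k<d. fst x $$ (a1, k) * cnj (fst x $$ (b, k))) * cnj (fst x $$ (snd x, c))"
      by (simp add: v2_def sum_distrib_left ac_simps)
    also have "\<dots> = v4 x a"
      using abc unitary_op_row_sum[OF inputsD(1)[OF x], of a1 b] by (simp add: v4_def)
    finally show ?thesis using abc by simp
  qed
  have pre: "?G v1 v1 x y = d * input_kernel x y" "?G v1 v2 x y = input_kernel x y"
    "?G v2 v1 x y = input_kernel x y" "?G v2 v2 x y = trace_kernel d x y * output_kernel d x y"
    if "x \<in> inputs d" "y \<in> inputs d" for x y
  proof -
    have "?G v2 v2 x y = (\<Sum>a<d. \<Sum>c<d. \<Sum>b<d. (fst x $$ (a, b) * cnj (fst y $$ (a, b)))
        * (cnj (fst x $$ (snd x, c)) * fst y $$ (snd y, c)))"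
      by (simp add: gram_def sum.cartesian_product' v2_def ac_simps)
    also have "\<dots> = trace_kernel d x y * output_kernel d x y"
      unfolding output_kernel_def trace_kernel_def sum_distrib_right[symmetric] sum_distrib_left[symmetric] ..
    finally show "?G v2 v2 x y = trace_kernel d x y * output_kernel d x y" .
    show "?G v1 v1 x y = d * input_kernel x y" "?G v1 v2 x y = input_kernel x y" "?G v2 v1 x y = input_kernel x y"
      using that[THEN inputsD(2)] unitary_op_row_sum[OF inputsD(1)[OF that(1)]]
        unitary_op_row_sum[OF inputsD(1)[OF that(2)]]
      by (simp_all add: v1_def v2_def input_kernel_def gram_simps mult.commute cong: if_cong)
  qed
  have post: "?G v3 v3 x y = cnj (trace_kernel d x y) * input_kernel x y" "?G v3 v4 x y = output_kernel d x y"
    "?G v4 v3 x y = output_kernel d x y" "?G v4 v4 x y = d * output_kernel d x y"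
    if "x \<in> inputs d" "y \<in> inputs d" for x y
  proof -
    have "?G v3 v3 x y = input_kernel x y * (\<Sum>c<d. \<Sum>b<d. cnj (fst x $$ (b, c)) * fst y $$ (b, c))"
      using that[THEN inputsD(2)] by (simp add: v3_def input_kernel_def gram_simps cong: if_cong)
    also have "(\<Sum>c<d. \<Sum>b<d. cnj (fst x $$ (b, c)) * fst y $$ (b, c)) = cnj (trace_kernel d x y)"
      unfolding trace_kernel_def by (subst sum.swap) simp
    finally show "?G v3 v3 x y = cnj (trace_kernel d x y) * input_kernel x y" by simp
    show "?G v3 v4 x y = output_kernel d x y" "?G v4 v3 x y = output_kernel d x y" "?G v4 v4 x y = d * output_kernel d x y"
      using that[THEN inputsD(2)]
      by (simp_all add: v3_def v4_def output_kernel_def gram_simps sum_distrib_left cong: if_cong)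
  qed
  show ?thesis
  proof (rule calls_cong[OF calls_conjugate[where s = ?s and P = ?A, OF d]])
    fix x y assume xy: "x \<in> inputs d" "y \<in> inputs d"
    show "?G ?s ?s x y = complex_of_real (d * p\<^sup>2 + 2 * (p * q)) * input_kernel x y
      + complex_of_real (q\<^sup>2) * (trace_kernel d x y * output_kernel d x y)"
      unfolding gram_lincomb pre[OF xy] by (simp add: algebra_simps)
    have "?G (\<lambda>x (c, b'). \<Sum>b<d. ?s x (c, b) * cnj (fst x $$ (b', b)))
        (\<lambda>x (c, b'). \<Sum>b<d. ?s x (c, b) * cnj (fst x $$ (b', b))) x y = ?G ?s' ?s' x y"
      unfolding gram_def by (intro sum.cong refl) (simp only: conj xy)
    then show "det (fst x) * cnj (det (fst y)) *
        ?G (\<lambda>x (c, b'). \<Sum>b<d. ?s x (c, b) * cnj (fst x $$ (b', b)))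
        (\<lambda>x (c, b'). \<Sum>b<d. ?s x (c, b) * cnj (fst x $$ (b', b))) x y
      = det (fst x) * cnj (det (fst y)) *
      (complex_of_real (p\<^sup>2) * (cnj (trace_kernel d x y) * input_kernel x y)
       + complex_of_real (2 * (p * q) + d * q\<^sup>2) * output_kernel d x y)"
      unfolding gram_lincomb post[OF xy] by (simp add: algebra_simps)
  qed simp
qed

subsection \<open>From kernels to circuits\<close>

lemma sum_div_mod:
  fixes g :: "nat \<Rightarrow> complex"
  shows "(\<Sum>m<k * d. g m) = (\<Sum>a<k. \<Sum>i<d. g (a * d + i))"
proof -
  have "(\<Sum>m<k * d. g m) = (\<Sum>a<k. sum g {a * d..<a * d + d})"
    by (rule sum.nat_group[symmetric])
  moreover have "sum g {a * d..<a * d + d} = (\<Sum>i<d. g (a * d + i))" for a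
    using sum.shift_bounds_nat_ivl[of g 0 "a * d" d] by (simp add: add.commute atLeast0LessThan)
  ultimately show ?thesis by simp
qed

lemma one_tensor_carrier [simp]:
  "U \<in> carrier_mat d d \<Longrightarrow> 1\<^sub>m k \<otimes>\<^sub>m U \<in> carrier_mat (k * d) (k * d)"
  by (auto simp: tensor_op_def)

lemma pair_index_less:
  "a < k \<Longrightarrow> i < d \<Longrightarrow> a * d + i < k * (d::nat)"
proof -
  assume "a < k" "i < d"
  then have "a * d + i < Suc a * d" by simp
  also have "\<dots> \<le> k * d" using \<open>a < k\<close> by (intro mult_le_mono1) simp
  finally show ?thesis .
qed

lemma one_tensor_mult_vec:
  assumes U: "U \<in> carrier_mat d d" and w: "w \<in> carrier_vec (k * d)" and a: "a < k" and i: "i < d"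
  shows "((1\<^sub>m k \<otimes>\<^sub>m U) *\<^sub>v w) $ (a * d + i) = (\<Sum>j<d. U $$ (i, j) * w $ (a * d + j))"
proof -
  have entry: "(1\<^sub>m k \<otimes>\<^sub>m U) $$ (a * d + i, b * d + j) = (if b = a then U $$ (i, j) else 0)"
    if "b < k" "j < d" for b j
    using that U a i pair_index_less[of a k i d] pair_index_less[of b k j d] by (simp add: tensor_op_def)
  have "((1\<^sub>m k \<otimes>\<^sub>m U) *\<^sub>v w) $ (a * d + i)
      = (\<Sum>b<k. \<Sum>j<d. (1\<^sub>m k \<otimes>\<^sub>m U) $$ (a * d + i, b * d + j) * w $ (b * d + j))"
    unfolding mult_mat_vec_sum[OF one_tensor_carrier[OF U] w pair_index_less[OF a i]] sum_div_mod ..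
  also have "\<dots> = (\<Sum>b<k. if b = a then \<Sum>j<d. U $$ (i, j) * w $ (a * d + j) else 0)"
    by (intro sum.cong refl) (auto simp: entry)
  finally show ?thesis using a by simp
qed

text \<open>The isometry adjoining the ancilla in state 0: under the index convention
  \<open>a * d + i\<close>, ancilla state 0 occupies the first \<open>d\<close> coordinates.\<close>

definition embed_mat :: "nat \<Rightarrow> nat \<Rightarrow> complex mat" where
  "embed_mat k d = mat (k * d) d (\<lambda>(m, i). if m = i then 1 else 0)"

lemma embed_mat_carrier [simp]: "embed_mat k d \<in> carrier_mat (k * d) d"
  by (simp add: embed_mat_def)

lemma embed_mat_mult_index:
  assumes "M \<in> carrier_mat d n" "m < k * d" "j < n"
  shows "(embed_mat k d * M) $$ (m, j) = (if m < d then M $$ (m, j) else 0)"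
proof -
  have "(embed_mat k d * M) $$ (m, j) = (\<Sum>i<d. if m = i then M $$ (i, j) else 0)"
  proof -
    have "(embed_mat k d * M) $$ (m, j) = (\<Sum>i<d. embed_mat k d $$ (m, i) * M $$ (i, j))"
      using assms by (simp add: scalar_prod_def atLeast0LessThan embed_mat_def)
    also have "\<dots> = (\<Sum>i<d. if m = i then M $$ (i, j) else 0)"
      using assms by (intro sum.cong) (simp_all add: embed_mat_def)
    finally show ?thesis .
  qed
  then show ?thesis by simp
qed

lemma ket_bra_tensor:
  assumes M: "M \<in> carrier_mat d d" and k: "0 < k"
  shows "ket_bra (unit_vec k 0) \<otimes>\<^sub>m M = embed_mat k d * M * mat_adjoint (embed_mat k d)"
proof (rule eq_matI)
  let ?R = "embed_mat k d * M * mat_adjoint (embed_mat k d)"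
  fix m n assume "m < dim_row ?R" "n < dim_col ?R"
  then have mn: "m < k * d" "n < k * d" by (auto simp: embed_mat_def)
  then have d: "0 < d" by (cases d) auto
  have EM: "embed_mat k d * M \<in> carrier_mat (k * d) d"
    using M by (intro mult_carrier_mat[of _ _ d]) auto
  have "?R $$ (m, n) = (\<Sum>i<d. (embed_mat k d * M) $$ (m, i) * cnj (embed_mat k d $$ (n, i)))"
    using mn EM by (auto simp: scalar_prod_def atLeast0LessThan embed_mat_def intro!: sum.cong)
  also have "\<dots> = (\<Sum>i<d. if n = i then (if m < d then M $$ (m, i) else 0) else 0)"
    using mn M by (intro sum.cong) (auto simp: embed_mat_mult_index[OF M], auto simp: embed_mat_def)
  finally have R: "?R $$ (m, n) = (if m < d \<and> n < d then M $$ (m, n) else 0)" by simp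
  have "m div d < k" "n div d < k" using mn by (auto simp: less_mult_imp_div_less)
  then show "(ket_bra (unit_vec k 0) \<otimes>\<^sub>m M) $$ (m, n) = ?R $$ (m, n)"
    unfolding R using M mn d k by (auto simp: tensor_op_def ket_bra_def div_eq_0_iff)
qed (use M in \<open>auto simp: tensor_op_def ket_bra_def embed_mat_def\<close>)

lemma one_smult_mat: "1 \<cdot>\<^sub>m A = (A :: complex mat)"
  by (rule eq_matI) auto

lemma sandwich_mult:
  fixes A J R :: "complex mat"
  assumes A: "A \<in> carrier_mat m n" and J: "J \<in> carrier_mat n p" and R: "R \<in> carrier_mat p p"
  shows "A * (J * R * mat_adjoint J) * mat_adjoint A = (A * J) * R * mat_adjoint (A * J)"
proof -
  have J': "mat_adjoint J \<in> carrier_mat p n" and A': "mat_adjoint A \<in> carrier_mat n m"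
    using A J by auto
  have JR: "J * R \<in> carrier_mat n p" and AJ: "A * J \<in> carrier_mat m p" using A J R by auto
  have AJR: "(A * J) * R \<in> carrier_mat m p" using AJ R by auto
  have "A * (J * R * mat_adjoint J) = (A * J) * R * mat_adjoint J"
    using assoc_mult_mat[OF A JR J'] assoc_mult_mat[OF A J R] by simp
  then show ?thesis
    using assoc_mult_mat[OF AJR J' A'] mat_adjoint_mult[OF A J] by simp
qed

lemma sandwich_smult:
  fixes A R :: "complex mat"
  assumes A: "A \<in> carrier_mat m n" and R: "R \<in> carrier_mat n n"
  shows "(c \<cdot>\<^sub>m A) * R * mat_adjoint (c \<cdot>\<^sub>m A) = (c * cnj c) \<cdot>\<^sub>m (A * R * mat_adjoint A)"
proof -
  have adj: "mat_adjoint (c \<cdot>\<^sub>m A) = cnj c \<cdot>\<^sub>m mat_adjoint A" by (rule eq_matI) auto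
  have AR: "A * R \<in> carrier_mat m n" and A': "mat_adjoint A \<in> carrier_mat n m" using A R by auto
  have "(c \<cdot>\<^sub>m A) * R * mat_adjoint (c \<cdot>\<^sub>m A) = c \<cdot>\<^sub>m (A * R * (cnj c \<cdot>\<^sub>m mat_adjoint A))"
    using A R AR A' by (simp add: adj mult_smult_assoc_mat[of _ m n _ n] mult_smult_assoc_mat[of _ m n _ m])
  also have "\<dots> = c \<cdot>\<^sub>m (cnj c \<cdot>\<^sub>m (A * R * mat_adjoint A))"
    using mult_smult_distrib[OF AR A'] by simp
  finally show ?thesis by (auto intro!: eq_matI)
qed

lemma circuit_carrier:
  assumes U: "U \<in> carrier_mat d d" and V: "\<And>i. i \<le> n \<Longrightarrow> V i \<in> carrier_mat (k * d) (k * d)"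
  shows "circuit k V U n \<in> carrier_mat (k * d) (k * d)"
  using V
proof (induction n)
  case (Suc n)
  then show ?case
    using one_tensor_carrier[OF U] by (auto intro!: mult_carrier_mat[of _ _ "k * d"])
qed simp

text \<open>Each pair of equal Gram kernels yields one fixed unitary between two calls. The final
  kernel is realised by \<phi>(U) times \<chi> next to the initial ancilla state, and the phase
  cancels in the channel.\<close>

lemma circuit_of_calls:
  assumes d: "0 < d"
    and calls: "calls d N input_kernel (\<lambda>x y. \<phi> (fst x) * cnj (\<phi> (fst y)) * output_kernel d x y)"
    and \<phi>: "\<And>U. unitary_op d U \<Longrightarrow> \<phi> U * cnj (\<phi> U) = 1"
  shows "\<exists>k anc V. anc \<in> carrier_vec k \<and> anc \<bullet>c anc = 1 \<and>
    (\<forall>i\<le>N. unitary_op (k * d) (V i)) \<and>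
    (\<forall>U. unitary_op d U \<longrightarrow> (\<forall>\<rho>. density_op d \<rho> \<longrightarrow>
        partial_trace_fst k d
          (circuit k V U N * (ket_bra anc \<otimes>\<^sub>m \<rho>) * mat_adjoint (circuit k V U N))
        = mat_adjoint U * \<rho> * U))"
proof -
  obtain K where K: "\<And>j. j < N \<Longrightarrow> call_step d (K j) (K (Suc j))"
    "\<And>x y. x \<in> inputs d \<Longrightarrow> y \<in> inputs d \<Longrightarrow> K 0 x y = input_kernel x y"
    "\<And>x y. x \<in> inputs d \<Longrightarrow> y \<in> inputs d \<Longrightarrow> K N x y = \<phi> (fst x) * cnj (\<phi> (fst y)) * output_kernel d x y"
    using callsE[OF calls] by metis
  have "\<forall>j. \<exists>k f. j < N \<longrightarrow> (\<forall>x\<in>inputs d. \<forall>y\<in>inputs d.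
     gram ({..<k::nat} \<times> {..<d}) f f x y = K j x y \<and>
     gram ({..<k} \<times> {..<d}) (apply_call d f) (apply_call d f) x y = K (Suc j) x y)"
    using K(1) unfolding call_step_def by blast
  then obtain kk f where f: "\<And>j x y. j < N \<Longrightarrow> x \<in> inputs d \<Longrightarrow> y \<in> inputs d \<Longrightarrow>
      gram ({..<kk j::nat} \<times> {..<d}) (f j) (f j) x y = K j x y"
    "\<And>j x y. j < N \<Longrightarrow> x \<in> inputs d \<Longrightarrow> y \<in> inputs d \<Longrightarrow>
      gram ({..<kk j} \<times> {..<d}) (apply_call d (f j)) (apply_call d (f j)) x y = K (Suc j) x y"
    by metis
  \<comment> \<open>One ancilla large enough for all families; the successor keeps it nonempty even
    for \<open>N = 0\<close>.\<close>
  define k where "k = Suc (\<Sum>j<N. kk j)"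
  have kk: "kk j \<le> k" if "j < N" for j
    using that member_le_sum[of j "{..<N}" kk] by (simp add: k_def)
  have k: "0 < k" by (simp add: k_def)
  have kd: "d \<le> k * d" using k by (cases k) auto
  \<comment> \<open>For \<open>j < N\<close> this is the state just before a call, padded by zeros
    to the common ancilla; for \<open>j = N\<close> it is the final state, with ancilla index
    0.\<close>
  define F where "F j x = (if j < N
      then vec (k * d) (\<lambda>m. if m div d < kk j then f j x (m div d, m mod d) else 0)
      else vec (k * d) (\<lambda>m. if m < d then \<phi> (fst x) * cnj (fst x $$ (snd x, m)) else 0))" for j x
  define call where "call x = 1\<^sub>m k \<otimes>\<^sub>m fst x" for x :: "complex mat \<times> nat"
  have Fc: "F j x \<in> carrier_vec (k * d)" for j x by (simp add: F_def)
  have callc: "call x \<in> carrier_mat (k * d) (k * d)" if "x \<in> inputs d" for x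
    using unitary_opD(1)[OF inputsD(1)[OF that]] by (simp add: call_def)
  have Fi: "F j x $ (a * d + i) = (if a < kk j then f j x (a, i) else 0)"
    if "j < N" "a < k" "i < d" for j x a i
    using that pair_index_less[of a k i d] by (simp add: F_def)
  have callFi: "(call x *\<^sub>v F j x) $ (a * d + i) = (if a < kk j then apply_call d (f j) x (a, i) else 0)"
    if "j < N" "x \<in> inputs d" "a < k" "i < d" for j x a i
    unfolding call_def one_tensor_mult_vec[OF unitary_opD(1)[OF inputsD(1)[OF that(2)]] Fc that(3,4)]
    using that by (simp add: Fi apply_call_def)
  have restrict: "(\<Sum>a<k. \<Sum>i<d. (if a < n then G a i else 0) * cnj (if a < n then H a i else 0))
      = (\<Sum>a<n. \<Sum>i<d. G a i * cnj (H a i))" if "n \<le> k" for n G H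
  proof -
    have "(\<Sum>a<n. \<Sum>i<d. G a i * cnj (H a i))
        = (\<Sum>a<k. \<Sum>i<d. (if a < n then G a i else 0) * cnj (if a < n then H a i else 0))"
      using that by (intro sum.mono_neutral_cong_left) auto
    then show ?thesis ..
  qed
  have gram_final: "F N x \<bullet>c F N y = K N x y" if xy: "x \<in> inputs d" "y \<in> inputs d" for x y
  proof -
    have "F N x \<bullet>c F N y = (\<Sum>m<k * d. if m < d then \<phi> (fst x) * cnj (fst x $$ (snd x, m))
        * cnj (\<phi> (fst y) * cnj (fst y $$ (snd y, m))) else 0)"
      unfolding cscalar_prod_sum[OF Fc] by (intro sum.cong) (auto simp: F_def)
    also have "\<dots> = (\<Sum>m<d. \<phi> (fst x) * cnj (fst x $$ (snd x, m))
        * cnj (\<phi> (fst y) * cnj (fst y $$ (snd y, m))))"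
      using kd by (intro sum.mono_neutral_cong_right) auto
    also have "\<dots> = K N x y"
      unfolding K(3)[OF xy] output_kernel_def by (simp add: sum_distrib_left ac_simps)
    finally show ?thesis .
  qed
  have gram_pre: "F j x \<bullet>c F j y = K j x y" if "j \<le> N" "x \<in> inputs d" "y \<in> inputs d" for j x y
  proof (cases "j = N")
    case False
    then have j: "j < N" using that by simp
    have "F j x \<bullet>c F j y = gram ({..<kk j} \<times> {..<d}) (f j) (f j) x y"
      unfolding cscalar_prod_sum[OF Fc] sum_div_mod gram_def sum.cartesian_product'
        restrict[OF kk[OF j], symmetric]
      using j by (intro sum.cong refl) (simp add: Fi)
    then show ?thesis using f(1) j that by simp
  qed (use gram_final that in simp)
  have gram_post: "(call x *\<^sub>v F j x) \<bullet>c (call y *\<^sub>v F j y) = K (Suc j) x y"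
    if j: "j < N" and xy: "x \<in> inputs d" "y \<in> inputs d" for j x y
  proof -
    have "(call x *\<^sub>v F j x) \<bullet>c (call y *\<^sub>v F j y)
        = gram ({..<kk j} \<times> {..<d}) (apply_call d (f j)) (apply_call d (f j)) x y"
      unfolding cscalar_prod_sum[OF mult_mat_vec_carrier[OF callc[OF xy(2)] Fc]]
        sum_div_mod gram_def sum.cartesian_product' restrict[OF kk[OF j], symmetric]
      using j xy by (intro sum.cong refl) (simp add: callFi)
    then show ?thesis using f(2) j xy by simp
  qed
  have unit: "(unit_vec (k * d) i :: complex vec) \<in> carrier_vec (k * d)" for i by simp
  have gram_unit: "unit_vec (k * d) (snd x) \<bullet>c unit_vec (k * d) (snd y) = K 0 x y"
    if xy: "x \<in> inputs d" "y \<in> inputs d" for x y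
  proof -
    have "snd x < k * d" "snd y < k * d" by (rule less_le_trans[OF inputsD(2)[OF xy(1)] kd], rule less_le_trans[OF inputsD(2)[OF xy(2)] kd])
    then have "unit_vec (k * d) (snd x) \<bullet>c unit_vec (k * d) (snd y)
        = (\<Sum>i<k * d. if i = snd x then (if snd x = snd y then 1 else 0 :: complex) else 0)"
      unfolding cscalar_prod_sum[OF unit] by (intro sum.cong) auto
    then show ?thesis
      unfolding K(2)[OF xy] input_kernel_def using \<open>snd x < k * d\<close> by simp
  qed
  have "\<exists>V. unitary_op (k * d) V \<and> (\<forall>x\<in>inputs d. V *\<^sub>v unit_vec (k * d) (snd x) = F 0 x)"
    by (rule unitary_op_of_gram) (simp_all add: Fc gram_unit gram_pre)
  then obtain V0 where V0: "unitary_op (k * d) V0"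
    "\<And>x. x \<in> inputs d \<Longrightarrow> V0 *\<^sub>v unit_vec (k * d) (snd x) = F 0 x" by blast
  have "\<exists>V. unitary_op (k * d) V \<and> (\<forall>x\<in>inputs d. V *\<^sub>v (call x *\<^sub>v F j x) = F (Suc j) x)"
    if "j < N" for j
    using that
    by (intro unitary_op_of_gram) (simp_all add: Fc gram_post gram_pre mult_mat_vec_carrier[OF callc Fc])
  then obtain V1 where V1: "\<And>j. j < N \<Longrightarrow> unitary_op (k * d) (V1 j)"
    "\<And>j x. j < N \<Longrightarrow> x \<in> inputs d \<Longrightarrow> V1 j *\<^sub>v (call x *\<^sub>v F j x) = F (Suc j) x"
    by metis
  define V where "V j = (case j of 0 \<Rightarrow> V0 | Suc i \<Rightarrow> V1 i)" for j
  have V: "unitary_op (k * d) (V j)" if "j \<le> N" for j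
    using that V0(1) V1(1) by (cases j) (auto simp: V_def)
  have run: "circuit k V (fst x) j *\<^sub>v unit_vec (k * d) (snd x) = F j x"
    if x: "x \<in> inputs d" and "j \<le> N" for x j
    using that(2)
  proof (induction j)
    case 0
    then show ?case using V0(2)[OF x] by (simp add: V_def)
  next
    case (Suc j)
    note Uc = unitary_opD(1)[OF inputsD(1)[OF x]]
    have Vc: "V (Suc j) \<in> carrier_mat (k * d) (k * d)" using unitary_opD(1)[OF V] Suc.prems by blast
    have cc: "circuit k V (fst x) j \<in> carrier_mat (k * d) (k * d)"
      using Suc.prems by (intro circuit_carrier Uc unitary_opD(1)[OF V]) auto
    have "circuit k V (fst x) (Suc j) *\<^sub>v unit_vec (k * d) (snd x)
        = V (Suc j) *\<^sub>v (call x *\<^sub>v (circuit k V (fst x) j *\<^sub>v unit_vec (k * d) (snd x)))"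
      using Vc cc callc[OF x] unfolding circuit.simps call_def[symmetric]
      by (simp add: assoc_mult_mat_vec[of _ "k * d" "k * d" _ "k * d"] mult_carrier_mat[of _ "k * d" "k * d" _ "k * d"])
    moreover have "V (Suc j) = V1 j" by (simp add: V_def)
    ultimately show ?case using Suc V1(2)[of j x] x by (simp del: circuit.simps)
  qed
  have "partial_trace_fst k d
          (circuit k V U N * (ket_bra (unit_vec k 0) \<otimes>\<^sub>m \<rho>) * mat_adjoint (circuit k V U N))
        = mat_adjoint U * \<rho> * U"
    if U: "unitary_op d U" and \<rho>: "density_op d \<rho>" for U \<rho>
  proof -
    note Uc = unitary_opD(1)[OF U]
    have \<rho>c: "\<rho> \<in> carrier_mat d d" using \<rho> by (simp add: density_op_def positive_op_def)
    let ?C = "circuit k V U N" and ?J = "embed_mat k d"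
    have C: "?C \<in> carrier_mat (k * d) (k * d)"
      by (intro circuit_carrier Uc unitary_opD(1)[OF V]) auto
    have J: "?J \<in> carrier_mat (k * d) d" by simp
    \<comment> \<open>Column \<open>i\<close> is the run on basis input \<open>i\<close>. By
      linearity these runs fix the circuit on every input with the ancilla in state 0, hence on
      every density operator.\<close>
    have CJ: "?C * ?J = \<phi> U \<cdot>\<^sub>m (?J * mat_adjoint U)"
    proof (rule eq_matI)
      fix m i assume "m < dim_row (\<phi> U \<cdot>\<^sub>m (?J * mat_adjoint U))" "i < dim_col (\<phi> U \<cdot>\<^sub>m (?J * mat_adjoint U))"
      then have mi: "m < k * d" "i < d" using Uc by (auto simp: embed_mat_def)
      have "col ?J i = unit_vec (k * d) i"
        using mi by (intro eq_vecI) (auto simp: embed_mat_def unit_vec_def)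
      then have "(?C * ?J) $$ (m, i) = (?C *\<^sub>v unit_vec (k * d) i) $ m"
        using mi C carrier_matD[OF J] by simp
      also have "\<dots> = F N (U, i) $ m"
        using run[of "(U, i)" N] U mi by (simp add: inputs_def)
      also have "\<dots> = (\<phi> U \<cdot>\<^sub>m (?J * mat_adjoint U)) $$ (m, i)"
        using mi Uc carrier_matD[OF J] embed_mat_mult_index[of "mat_adjoint U" d d m k i] by (simp add: F_def)
      finally show "(?C * ?J) $$ (m, i) = (\<phi> U \<cdot>\<^sub>m (?J * mat_adjoint U)) $$ (m, i)" .
    qed (use C J Uc in \<open>auto simp: embed_mat_def\<close>)
    let ?M = "mat_adjoint U * \<rho> * U"
    have M: "?M \<in> carrier_mat d d" using Uc \<rho>c by (auto intro!: mult_carrier_mat[of _ d d])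
    have "?C * (ket_bra (unit_vec k 0) \<otimes>\<^sub>m \<rho>) * mat_adjoint ?C = (?C * ?J) * \<rho> * mat_adjoint (?C * ?J)"
      unfolding ket_bra_tensor[OF \<rho>c k] by (rule sandwich_mult[OF C J \<rho>c])
    also have "\<dots> = (\<phi> U * cnj (\<phi> U)) \<cdot>\<^sub>m ((?J * mat_adjoint U) * \<rho> * mat_adjoint (?J * mat_adjoint U))"
      unfolding CJ using J Uc \<rho>c by (intro sandwich_smult[of _ "k * d" d] mult_carrier_mat[of _ _ d]) auto
    also have "\<dots> = (?J * mat_adjoint U) * \<rho> * mat_adjoint (?J * mat_adjoint U)"
      unfolding \<phi>[OF U] one_smult_mat ..
    also have "\<dots> = ?J * (mat_adjoint U * \<rho> * mat_adjoint (mat_adjoint U)) * mat_adjoint ?J"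
      by (rule sandwich_mult[OF J _ \<rho>c, symmetric]) (use Uc in simp)
    also have "\<dots> = ket_bra (unit_vec k 0) \<otimes>\<^sub>m ?M"
      using ket_bra_tensor[OF M k] by simp
    finally have "partial_trace_fst k d (?C * (ket_bra (unit_vec k 0) \<otimes>\<^sub>m \<rho>) * mat_adjoint ?C)
        = (\<Sum>a<k. ket_bra (unit_vec k 0) $$ (a, a)) \<cdot>\<^sub>m ?M"
      using M by (simp add: partial_trace_fst_tensor_op ket_bra_def)
    also have "(\<Sum>a<k. ket_bra (unit_vec k 0) $$ (a, a)) = (\<Sum>a<k. if a = 0 then 1 else 0)"
      using k by (intro sum.cong) (auto simp: ket_bra_def)
    also have "\<dots> = 1" using k by simp
    finally show ?thesis unfolding one_smult_mat .
  qed
  moreover have "unit_vec k 0 \<bullet>c unit_vec k 0 = (1 :: complex)"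
    using k by (subst cscalar_prod_sum[of _ k]) (auto simp: if_distrib unit_vec_def cong: if_cong)
  ultimately show ?thesis
    using V by (intro exI[of _ k] exI[of _ "unit_vec k 0"] exI[of _ V]) simp
qed

subsection \<open>Rotation towards the inverse\<close>

text \<open>With \<open>S = sin \<theta>\<close> and \<open>K = cos \<theta>\<close>, the state \<open>K \<psi>\<^sub>A \<Phi>\<^sub>B\<^sub>C + S a\<close>, where \<open>a\<close> is the idle state, equals
  \<open>p v\<^sub>1 + q v\<^sub>2\<close> for the vectors \<open>v\<^sub>1, v\<^sub>2\<close> of \<open>calls_conjugate_pair\<close>.\<close>

lemma rotation_coefficients:
  fixes S K r c D :: real
  assumes D: "2 \<le> D" and r: "r = 1 / (D\<^sup>2 - 1)" and c: "c = sqrt (1 - 1 / D\<^sup>2)"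
    and SK: "S\<^sup>2 + K\<^sup>2 = 1"
  defines "p \<equiv> (K - S / (D * c)) / sqrt D" and "q \<equiv> S / c / sqrt D"
  shows "D * p\<^sup>2 + 2 * (p * q) = K\<^sup>2 - S\<^sup>2 * r" "q\<^sup>2 = S\<^sup>2 * r * D"
    "p\<^sup>2 = (K * c - S / D)\<^sup>2 * r * D" "2 * (p * q) + D * q\<^sup>2 = (S * c + K / D)\<^sup>2 - (K * c - S / D)\<^sup>2 * r"
proof -
  have D2: "D\<^sup>2 > 1" using D by (simp add: one_less_power)
  then have D0: "D > 0" "D\<^sup>2 - 1 > 0" using D by auto
  have lt: "1 / D\<^sup>2 < 1" using D2 by (subst divide_less_eq_1_pos) auto
  then have c0: "c > 0" and "c\<^sup>2 = 1 - 1 / D\<^sup>2" by (simp_all add: c)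
  then have c2: "c\<^sup>2 = (D\<^sup>2 - 1) / D\<^sup>2" using D0 by (simp add: field_simps)
  have rc: "r * (c\<^sup>2 * D\<^sup>2) = 1" using D0 by (simp add: r c2)
  have c2r: "inverse (c\<^sup>2) = r * D\<^sup>2"
    using rc c0 D0 by (simp add: field_simps)
  \<comment> \<open>With \<open>a\<close> and \<open>b\<close> equal to \<open>p\<close> and
    \<open>q\<close> times \<open>sqrt D\<close>, all quantities become polynomial:
    \<open>K = a + b / D\<close>, \<open>S = b * c\<close>, and the rotated cosine and sine are
    \<open>a * c\<close> and \<open>a / D + b\<close>.\<close>
  define a where "a = K - S / (D * c)"
  define b where "b = S / c"
  have ab: "p\<^sup>2 = a\<^sup>2 / D" "p * q = a * b / D" "q\<^sup>2 = b\<^sup>2 / D"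
    using D0 by (simp_all add: p_def q_def a_def b_def power_divide power_mult_distrib)
  have b2: "b\<^sup>2 = S\<^sup>2 * (r * D\<^sup>2)"
    unfolding b_def power_divide unfolding divide_inverse c2r ..
  have K: "K = a + b / D" by (simp add: a_def b_def)
  have S: "S = b * c" using c0 by (simp add: b_def)
  have cos: "K * c - S / D = a * c" by (simp add: K S algebra_simps)
  have sin: "S * c + K / D = a / D + b"
  proof -
    have "S * c + K / D = a / D + b * (c\<^sup>2 + 1 / D\<^sup>2)"
      by (simp add: K S algebra_simps power2_eq_square add_divide_distrib)
    also have "c\<^sup>2 + 1 / D\<^sup>2 = 1" using D0 unfolding c2 by (simp add: field_simps)
    finally show ?thesis by simp
  qed
  show "q\<^sup>2 = S\<^sup>2 * r * D"
    unfolding ab b2 using D0 by (simp add: power2_eq_square)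
  have "S\<^sup>2 * r = b\<^sup>2 / D\<^sup>2" unfolding b2 using D0 by simp
  then show "D * p\<^sup>2 + 2 * (p * q) = K\<^sup>2 - S\<^sup>2 * r"
    unfolding ab K using D0 by (simp add: field_simps power2_eq_square)
  have arc: "(a * c)\<^sup>2 * r = a\<^sup>2 / D\<^sup>2" using rc D0 by (simp add: field_simps power_mult_distrib)
  then show "p\<^sup>2 = (K * c - S / D)\<^sup>2 * r * D"
    unfolding cos ab using D0 by (simp add: power2_eq_square)
  show "2 * (p * q) + D * q\<^sup>2 = (S * c + K / D)\<^sup>2 - (K * c - S / D)\<^sup>2 * r"
    unfolding cos sin arc ab using D0 by (simp add: field_simps power2_eq_square)
qed

text \<open>The success amplitude gets \<open>cos \<theta> * sin \<Delta>\<close> from \<psi> and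
  \<open>sin \<theta> * cos \<Delta>\<close> from the idle state; the addition formula joins
  them.\<close>

lemma calls_rotate:
  assumes d: "2 \<le> d" and \<Delta>: "\<Delta> = arcsin (1 / real d)"
  shows "calls d (d - 1)
    (\<lambda>x y. complex_of_real ((cos \<theta>)\<^sup>2) * input_kernel x y + complex_of_real ((sin \<theta>)\<^sup>2) * idle_kernel d x y)
    (\<lambda>x y. det (fst x) * cnj (det (fst y)) *
      (complex_of_real ((cos (\<theta> + \<Delta>))\<^sup>2) * failure_kernel d x y
       + complex_of_real ((sin (\<theta> + \<Delta>))\<^sup>2) * output_kernel d x y))"
proof -
  define r where "r = 1 / ((real d)\<^sup>2 - 1)"
  define c where "c = sqrt (1 - 1 / (real d)\<^sup>2)"
  define p where "p = (cos \<theta> - sin \<theta> / (real d * c)) / sqrt (real d)"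
  define q where "q = sin \<theta> / c / sqrt (real d)"
  have "-1 \<le> 1 / real d" "1 / real d \<le> 1" using d by (auto simp: field_simps)
  then have sin\<Delta>: "sin \<Delta> = 1 / real d" and cos\<Delta>: "cos \<Delta> = c"
    unfolding \<Delta> c_def by (simp_all add: cos_arcsin power_divide)
  have D: "2 \<le> real d" using d by simp
  note coef = rotation_coefficients[OF D r_def c_def sin_cos_squared_add, of \<theta>, folded p_def q_def]
  have cos: "cos (\<theta> + \<Delta>) = cos \<theta> * c - sin \<theta> / real d"
    and sin: "sin (\<theta> + \<Delta>) = sin \<theta> * c + cos \<theta> / real d"
    by (simp_all add: cos_add sin_add sin\<Delta> cos\<Delta>)
  show ?thesis
  proof (rule calls_cong[OF calls_conjugate_pair[of d p q]])
    show "complex_of_real (real d * p\<^sup>2 + 2 * (p * q)) * input_kernel x y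
      + complex_of_real (q\<^sup>2) * (trace_kernel d x y * output_kernel d x y)
      = complex_of_real ((cos \<theta>)\<^sup>2) * input_kernel x y + complex_of_real ((sin \<theta>)\<^sup>2) * idle_kernel d x y" for x y
      unfolding coef(1,2) idle_kernel_def r_def[symmetric] by (simp add: algebra_simps)
    show "det (fst x) * cnj (det (fst y)) *
      (complex_of_real (p\<^sup>2) * (cnj (trace_kernel d x y) * input_kernel x y)
       + complex_of_real (2 * (p * q) + real d * q\<^sup>2) * output_kernel d x y)
      = det (fst x) * cnj (det (fst y)) *
      (complex_of_real ((cos (\<theta> + \<Delta>))\<^sup>2) * failure_kernel d x y
       + complex_of_real ((sin (\<theta> + \<Delta>))\<^sup>2) * output_kernel d x y)" for x y
      unfolding cos sin coef(3,4) failure_kernel_def r_def[symmetric]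
      by (intro arg_cong2[where f = "(*)"] refl) (simp add: algebra_simps)
  qed (use d in simp)
qed

text \<open>Three orthogonal branches share one call: failure returns to \<psi>, success of weight
  \<open>(sin \<phi>)\<^sup>2\<close> becomes idle, and the surplus success also returns to \<psi>.
  The two returning weights add up to \<open>(cos \<phi>)\<^sup>2\<close>.\<close>

lemma call_step_restart:
  assumes d: "2 \<le> d" and le: "(sin \<phi>)\<^sup>2 \<le> (sin \<theta>)\<^sup>2"
  shows "call_step d
    (\<lambda>x y. complex_of_real ((cos \<theta>)\<^sup>2) * failure_kernel d x y + complex_of_real ((sin \<theta>)\<^sup>2) * output_kernel d x y)
    (\<lambda>x y. complex_of_real ((cos \<phi>)\<^sup>2) * input_kernel x y + complex_of_real ((sin \<phi>)\<^sup>2) * idle_kernel d x y)"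
proof -
  have "call_step d
    (\<lambda>x y. complex_of_real ((cos \<theta>)\<^sup>2) * failure_kernel d x y
      + (complex_of_real ((sin \<theta>)\<^sup>2 - (sin \<phi>)\<^sup>2) * output_kernel d x y + complex_of_real ((sin \<phi>)\<^sup>2) * output_kernel d x y))
    (\<lambda>x y. complex_of_real ((cos \<theta>)\<^sup>2) * input_kernel x y
      + (complex_of_real ((sin \<theta>)\<^sup>2 - (sin \<phi>)\<^sup>2) * input_kernel x y + complex_of_real ((sin \<phi>)\<^sup>2) * idle_kernel d x y))"
    by (intro call_step_add call_step_scale call_step_failure_input call_step_output_input call_step_output_idle d) (use le in auto)
  then show ?thesis
    by (rule call_step_cong) (simp_all add: cos_squared_eq algebra_simps)
qed

text \<open>The first round starts at angle 0 and needs \<open>d - 1\<close> calls; every later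
  round adds a restarting call, hence \<open>d\<close> calls in all.\<close>

lemma calls_angle:
  assumes d: "2 \<le> d" and \<Delta>: "\<Delta> = arcsin (1 / real d)"
  shows "calls d (d * Suc n - 1) input_kernel
    (\<lambda>x y. det (fst x) ^ Suc n * cnj (det (fst y) ^ Suc n) *
      (complex_of_real ((cos (min (real (Suc n) * \<Delta>) (pi / 2)))\<^sup>2) * failure_kernel d x y
       + complex_of_real ((sin (min (real (Suc n) * \<Delta>) (pi / 2)))\<^sup>2) * output_kernel d x y))"
proof -
  have x: "-1 \<le> 1 / real d" "1 / real d \<le> 1" "0 < 1 / real d" using d by (auto simp: field_simps)
  have \<Delta>0: "0 \<le> \<Delta>" using arcsin_le_arcsin[of 0 "1 / real d"] x by (simp add: \<Delta>)
  have \<Delta>1: "\<Delta> \<le> pi / 2" using arcsin_ubound[of "1 / real d"] x by (simp add: \<Delta>)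
  show ?thesis
  proof (induction n)
    case 0
    have "calls d (d - 1) input_kernel (\<lambda>x y. det (fst x) * cnj (det (fst y)) *
      (complex_of_real ((cos \<Delta>)\<^sup>2) * failure_kernel d x y + complex_of_real ((sin \<Delta>)\<^sup>2) * output_kernel d x y))"
      by (rule calls_cong[OF calls_rotate[OF d \<Delta>, of 0]]) simp_all
    moreover have "min (real (Suc 0) * \<Delta>) (pi / 2) = \<Delta>" using \<Delta>1 by simp
    ultimately show ?case by simp
  next
    case (Suc n)
    define \<theta> where "\<theta> = min (real (Suc n) * \<Delta>) (pi / 2)"
    \<comment> \<open>The starting angle of the next round, capped so that adding \<Delta> cannot
      pass \<open>pi / 2\<close>.\<close>
    define \<phi> where "\<phi> = min (real (Suc n) * \<Delta>) (pi / 2 - \<Delta>)"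
    have "\<phi> \<le> real (Suc n) * \<Delta>" "\<phi> \<le> pi / 2 - \<Delta>" by (simp_all add: \<phi>_def)
    then have "\<phi> \<le> \<theta>" using \<Delta>0 by (simp add: \<theta>_def)
    moreover have "0 \<le> \<phi>" "\<theta> \<le> pi / 2" using \<Delta>0 \<Delta>1 by (auto simp: \<theta>_def \<phi>_def)
    ultimately have "0 \<le> \<phi>" "\<phi> \<le> \<theta>" "\<theta> \<le> pi / 2" "0 \<le> \<theta>" by auto
    then have "0 \<le> sin \<phi>" "sin \<phi> \<le> sin \<theta>"
      by (auto intro!: sin_monotone_2pi_le sin_ge_zero)
    then have le: "(sin \<phi>)\<^sup>2 \<le> (sin \<theta>)\<^sup>2" by (intro power_mono) auto
    have angle: "\<phi> + \<Delta> = min (real (Suc (Suc n)) * \<Delta>) (pi / 2)"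
      by (auto simp: \<phi>_def min_def algebra_simps)
    \<comment> \<open>The determinant phase accumulated so far; being a scalar for each run, it
      passes through the later calls.\<close>
    define P where "P x = det (fst x) ^ Suc n" for x :: "complex mat \<times> nat"
    note restart = calls_phase[OF calls_single[OF call_step_restart[OF d le]], of P]
    note rotate = calls_phase[OF calls_rotate[OF d \<Delta>, of \<phi>], of P]
    have count: "d * Suc n - 1 + 1 + (d - 1) = d * Suc (Suc n) - 1"
      using d by (simp add: algebra_simps)
    have "calls d (d * Suc n - 1 + 1 + (d - 1)) input_kernel
      (\<lambda>x y. P x * cnj (P y) * (det (fst x) * cnj (det (fst y)) *
        (complex_of_real ((cos (\<phi> + \<Delta>))\<^sup>2) * failure_kernel d x y
         + complex_of_real ((sin (\<phi> + \<Delta>))\<^sup>2) * output_kernel d x y)))"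
      by (rule calls_trans[OF calls_trans[OF Suc.IH[folded \<theta>_def P_def] restart] rotate])
    from calls_cong[OF this[unfolded count angle]] show ?case
      by (simp add: P_def ac_simps)
  qed
qed

section \<open>Unit modulus of the phase and the number of rounds\<close>

lemma unitary_op_det:
  assumes U: "unitary_op d U"
  shows "det U * cnj (det U) = 1"
proof -
  interpret cnj: comm_ring_hom cnj by unfold_locales simp_all
  note Uc = unitary_opD[OF U]
  have "mat_adjoint U = map_mat cnj (transpose_mat U)"
    by (rule eq_matI) auto
  then have "det (mat_adjoint U) = cnj (det U)"
    using Uc(1) by (simp add: det_transpose cnj.hom_det)
  then show ?thesis
    using det_mult[OF Uc(1) mat_adjoint_carrier[OF Uc(1)]] Uc(3) by simp
qed

lemma calls_inverse:
  assumes d: "1 \<le> d" and m: "m = nat \<lceil>pi / (2 * arcsin (1 / real d))\<rceil>"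
  shows "0 < m" "calls d (d * m - 1) input_kernel
    (\<lambda>x y. det (fst x) ^ m * cnj (det (fst y) ^ m) * output_kernel d x y)"
proof -
  have x: "0 < 1 / real d" "1 / real d \<le> 1" using d by auto
  have pos: "0 < arcsin (1 / real d)"
    using arcsin_less_arcsin[of 0 "1 / real d"] x by simp
  have "0 < \<lceil>pi / (2 * arcsin (1 / real d))\<rceil>" using pos by simp
  then show m0: "0 < m" by (simp add: m)
  then obtain n where n: "m = Suc n" by (cases m) auto
  show "calls d (d * m - 1) input_kernel (\<lambda>x y. det (fst x) ^ m * cnj (det (fst y) ^ m) * output_kernel d x y)"
  proof (cases "d = 1")
    \<comment> \<open>Here \<Delta> is \<open>pi / 2\<close>, so \<open>m = 1\<close> and no call is
      made: \<open>U\<close> is a scalar equal to its determinant, and \<chi> differs from \<psi> by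
      a phase.\<close>
    case True
    have unit: "fst x $$ (0, 0) * cnj (fst x $$ (0, 0)) = 1" if "x \<in> inputs 1" for x
      using unitary_op_row_sum[OF inputsD(1)[OF that], of 0 0] by simp
    have det: "det (fst x) = fst x $$ (0, 0)" if "x \<in> inputs 1" for x
      using det_single[OF unitary_opD(1)[OF inputsD(1)[OF that]]] .
    have "input_kernel x y = det (fst x) * cnj (det (fst y)) * output_kernel 1 x y"
      if xy: "x \<in> inputs 1" "y \<in> inputs 1" for x y
    proof -
      have "snd x = 0" "snd y = 0" using xy[THEN inputsD(2)] by auto
      then have "det (fst x) * cnj (det (fst y)) * output_kernel 1 x y
          = (fst x $$ (0, 0) * cnj (fst x $$ (0, 0))) * (fst y $$ (0, 0) * cnj (fst y $$ (0, 0)))"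
        using xy by (simp add: det output_kernel_def)
      with unit xy \<open>snd x = 0\<close> \<open>snd y = 0\<close> show ?thesis by (simp add: input_kernel_def)
    qed
    moreover have "m = 1" using True by (simp add: m)
    ultimately show ?thesis
      using True by (intro callsI[of _ _ "\<lambda>_. input_kernel"]) auto
  next
    case False
    with d have d2: "2 \<le> d" by simp
    \<comment> \<open>After \<open>m\<close> rounds the angle has reached \<open>pi / 2\<close>,
      where the failure weight is zero.\<close>
    have "pi / (2 * arcsin (1 / real d)) \<le> real m" by (simp add: m) linarith
    then have "pi / 2 \<le> real m * arcsin (1 / real d)"
      using pos by (simp add: field_simps)
    then have "min (real (Suc n) * arcsin (1 / real d)) (pi / 2) = pi / 2"
      unfolding n by simp
    with calls_angle[OF d2 refl, of n] show ?thesis by (simp add: n)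
  qed
qed

theorem theorem1:
  fixes d :: nat
  assumes "d \<ge> 1"
  shows "\<exists>(N::nat) (k::nat) (anc::complex vec) (V::nat \<Rightarrow> complex mat).
    int N \<le> int d * \<lceil>pi / (2 * arcsin (1 / real d))\<rceil> - 1 \<and>
    anc \<in> carrier_vec k \<and> anc \<bullet>c anc = 1 \<and>
    (\<forall>i\<le>N. unitary_op (k * d) (V i)) \<and>
    (\<forall>U. unitary_op d U \<longrightarrow>
      (\<forall>\<rho>. density_op d \<rho> \<longrightarrow>
        partial_trace_fst k d
          (circuit k V U N * (ket_bra anc \<otimes>\<^sub>m \<rho>) * mat_adjoint (circuit k V U N))
        = mat_adjoint U * \<rho> * U))"
proof -
  define m where "m = nat \<lceil>pi / (2 * arcsin (1 / real d))\<rceil>"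
  note m = calls_inverse[OF assms m_def]
  have "\<exists>k anc V. anc \<in> carrier_vec k \<and> anc \<bullet>c anc = 1 \<and>
    (\<forall>i\<le>d * m - 1. unitary_op (k * d) (V i)) \<and>
    (\<forall>U. unitary_op d U \<longrightarrow> (\<forall>\<rho>. density_op d \<rho> \<longrightarrow>
        partial_trace_fst k d
          (circuit k V U (d * m - 1) * (ket_bra anc \<otimes>\<^sub>m \<rho>) * mat_adjoint (circuit k V U (d * m - 1)))
        = mat_adjoint U * \<rho> * U))"
  proof (rule circuit_of_calls[where \<phi> = "\<lambda>U. det U ^ m"])
    show "0 < d" using assms by simp
    show "calls d (d * m - 1) input_kernel (\<lambda>x y. det (fst x) ^ m * cnj (det (fst y) ^ m) * output_kernel d x y)"
      by (rule m(2))
    show "det U ^ m * cnj (det U ^ m) = 1" if "unitary_op d U" for U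
      using unitary_op_det[OF that] by (simp flip: power_mult_distrib)
  qed
  moreover have "int (d * m - 1) \<le> int d * \<lceil>pi / (2 * arcsin (1 / real d))\<rceil> - 1"
  proof -
    \<comment> \<open>Positivity makes the natural subtraction agree with the integer one.\<close>
    have "0 < d * m" using m(1) assms by simp
    then have "int (d * m - 1) = int d * int m - 1" by (simp add: of_nat_diff)
    also have "int m = \<lceil>pi / (2 * arcsin (1 / real d))\<rceil>" using m(1) by (simp add: m_def)
    finally show ?thesis by simp
  qed
  ultimately show ?thesis by blast
qed

end
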